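(* Let $M\subset\mathbb{R}^n$ be compact and connected by rectifiable arcs, and assume there exist $\varepsilon_0>0$, $C_1>0$ such that $d_M(x,y)\le|x-y|+C_1|x-y|^2$ for all $(x,y)\in M\times M$ with $d_M(x,y)\le\varepsilon_0$. Let $C_2\in(0,\bar C_2]$, where $\bar C_2:=\inf\{|x-y|/d_M(x,y)\colon (x,y)\in M\times M,\ x\ne y\}$. Let $\{y_i\}_{i\in\mathbb{N}}\subset M$ be a dense set of (distinct) points in $M$ and $d_{ij}:=d_M(y_i,y_j)$. Let $0<\varepsilon<\varepsilon_0$ and, for $k\in\mathbb{N}$, let $(x_i^k)_{i=1}^k\in(\mathbb{R}^n)^k$ be a minimizer of $$F_{\varepsilon,k}(x_1,\ldots,x_k):=\max\left\{\left|\frac{|x_i-x_j|^2}{d_{ij}^2}-1\right|\colon i,j=1,\ldots,k,\ i\ne j,\ d_{ij}<\varepsilon\right\}$$ over the set $$X^k:=\{(x_i)_{i=1}^k\in(\mathbb{R}^n)^k\colon |x_i-x_j|\ge C_2 d_{ij},\ i,j=1,\ldots,k\}.$$ Then, up to a subsequence, one has $x_i^k\to x_i$ as $k\to\infty$, and $$d_{ij}(1-2C_1\varepsilon)\le|x_i-x_j|\le d_{ij}(1+2C_1\varepsilon)$$ whenever $d_{ij}<\varepsilon$. Further, $$d_{ij}(1-2C_1\varepsilon)\le d_\Sigma(x_i,x_j)\le d_{ij}(1+2C_1\varepsilon)$$ for all $\{i,j\}\subset\mathbb{N}$, where $\Sigma:=f(M)$ and $f\colon M\to\mathbb{R}^n$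 is the continuous map with $f(y_i)=x_i$ for all $i\in\mathbb{N}$. In particular, the statement is valid when $M$ is a $C^{1,1}$ smooth (connected) compact Riemannian submanifold of $\mathbb{R}^n$ with $\varepsilon_0:=\alpha:=\mathrm{Reach}(M)$, $C_1:=(3\alpha\sqrt3)^{-1}$ and $C_2:=\min\{2/\pi,\,2\alpha/D\}$, where $D$ is the intrinsic diameter of $M$ (i.e. its diameter with respect to $d_M$).
   Context: $|\cdot|$ is the Euclidean norm. For a set $S\subset\mathbb{R}^n$ (here $S=M$ or $S=\Sigma$), $d_S(u,v):=\inf\{\ell(\theta)\colon \theta\colon[0,1]\to S,\ \theta(0)=u,\ \theta(1)=v\}$ is the geodesic distance, $\ell(\theta)$ being the Euclidean length of $\theta$. "Connected by rectifiable arcs" means that any two points of $M$ are joined by a curve in $M$ of finite length. $\mathrm{Reach}(M):=\sup\{\varepsilon>0\colon$ every point of the open $\varepsilon$-neighborhood of $M$ has a unique projection (nearest point) on $M\}$. The maximum over the empty set is taken to be $0$.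
   Formalization: Since F and X^k are translation invariant, minimizers may escape to infinity and have no convergent subsequence; convergence is therefore stated up to a subsequence and translations τ_k, with τ_k = 0 whenever the first points x_1^k do not tend to infinity. *)

theory Defs
  imports "HOL-Analysis.Analysis"
begin

definition curve_length :: "(real \<Rightarrow> 'a::metric_space) \<Rightarrow> ereal" where
  "curve_length \<theta> =
     Sup {ereal (\<Sum>i<N. dist (\<theta> (t i)) (\<theta> (t (Suc i)))) | (N::nat) (t::nat \<Rightarrow> real).
            t 0 = 0 \<and> t N = 1 \<and> (\<forall>i<N. t i \<le> t (Suc i))}"

text \<open>The geodesic distance is infinite if no rectifiable curve in \<open>S\<close> joins \<open>u\<close> and \<open>v\<close>;
  \<open>gdist\<close> is its real value, used only where it is finite.\<close>

definition geodesic_dist :: "'a::metric_space set \<Rightarrow> 'a \<Rightarrow> 'a \<Rightarrow> ereal" where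
  "geodesic_dist S u v =
     Inf {curve_length \<theta> | \<theta>.
            path \<theta> \<and> path_image \<theta> \<subseteq> S \<and> pathstart \<theta> = u \<and> pathfinish \<theta> = v}"

definition gdist :: "'a::metric_space set \<Rightarrow> 'a \<Rightarrow> 'a \<Rightarrow> real" where
  "gdist S u v = real_of_ereal (geodesic_dist S u v)"

definition rectifiably_connected :: "'a::metric_space set \<Rightarrow> bool" where
  "rectifiably_connected S \<longleftrightarrow>
     (\<forall>u\<in>S. \<forall>v\<in>S. \<exists>\<theta>. path \<theta> \<and> path_image \<theta> \<subseteq> S \<and> pathstart \<theta> = u \<and> pathfinish \<theta> = v \<and>
                    curve_length \<theta> < \<infinity>)"

definition intrinsic_diameter :: "'a::metric_space set \<Rightarrow> ereal" where
  "intrinsic_diameter S = (SUP u\<in>S. SUP v\<in>S. geodesic_dist S u v)"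

definition reach :: "'a::metric_space set \<Rightarrow> ereal" where
  "reach S =
     Sup {ereal e | e. 0 < e \<and>
            (\<forall>p \<in> (\<Union>q\<in>S. ball q e). \<exists>!q. q \<in> S \<and> (\<forall>q'\<in>S. dist p q \<le> dist p q'))}"

definition C11_on :: "'a::real_normed_vector set \<Rightarrow> ('a \<Rightarrow> 'b::real_normed_vector) \<Rightarrow> bool" where
  "C11_on U f \<longleftrightarrow>
     (\<exists>f'. (\<forall>x\<in>U. (f has_derivative blinfun_apply (f' x)) (at x)) \<and>
           (\<forall>x\<in>U. \<exists>e>0. \<exists>L. L-lipschitz_on (ball x e \<inter> U) f'))"

text \<open>Embedded submanifolds without boundary, of some constant dimension \<open>m\<close>: locally, a
  \<open>C\<^sup>1\<^sup>,\<^sup>1\<close> diffeomorphism of open sets of the ambient space straightens \<open>M\<close> to a linear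
  subspace. The Riemannian metric is the one induced by the ambient space, so that its distance
  is \<open>geodesic_dist M\<close>.\<close>

definition C11_submanifold :: "'a::euclidean_space set \<Rightarrow> bool" where
  "C11_submanifold M \<longleftrightarrow>
     (\<exists>m. \<forall>p\<in>M. \<exists>U (V :: 'a set) \<phi> \<psi> L.
        open U \<and> p \<in> U \<and> open V \<and> homeomorphism U V \<phi> \<psi> \<and> C11_on U \<phi> \<and> C11_on V \<psi> \<and>
        subspace L \<and> dim L = m \<and> \<phi> ` (M \<inter> U) = V \<inter> L)"

definition C2_bar :: "'a::real_normed_vector set \<Rightarrow> real" where
  "C2_bar M = Inf {norm (x - y) / gdist M x y | x y. x \<in> M \<and> y \<in> M \<and> x \<noteq> y}"

definition embedding_assms :: "'a::real_normed_vector set \<Rightarrow> real \<Rightarrow> real \<Rightarrow> real \<Rightarrow> bool" where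
  "embedding_assms M \<epsilon>\<^sub>0 C\<^sub>1 C\<^sub>2 \<longleftrightarrow>
     compact M \<and> rectifiably_connected M \<and> 0 < \<epsilon>\<^sub>0 \<and> 0 < C\<^sub>1 \<and>
     (\<forall>x\<in>M. \<forall>y\<in>M. gdist M x y \<le> \<epsilon>\<^sub>0 \<longrightarrow> gdist M x y \<le> norm (x - y) + C\<^sub>1 * (norm (x - y))\<^sup>2) \<and>
     0 < C\<^sub>2 \<and> C\<^sub>2 \<le> C2_bar M"

text \<open>Sequences are indexed from \<open>0\<close>. A \<open>k\<close>-tuple of points is a function on \<open>nat\<close> of which only
  the values below \<open>k\<close> matter. In both definitions \<open>d\<close> is the matrix of the distances between the
  data points.\<close>

definition distortion :: "(nat \<Rightarrow> nat \<Rightarrow> real) \<Rightarrow> real \<Rightarrow> nat \<Rightarrow> (nat \<Rightarrow> 'a::real_normed_vector) \<Rightarrow> real" where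
  "distortion d \<epsilon> k z =
     (let A = {\<bar>(norm (z i - z j))\<^sup>2 / (d i j)\<^sup>2 - 1\<bar> | i j. i < k \<and> j < k \<and> i \<noteq> j \<and> d i j < \<epsilon>}
      in if A = {} then 0 else Max A)"

definition feasible :: "(nat \<Rightarrow> nat \<Rightarrow> real) \<Rightarrow> real \<Rightarrow> nat \<Rightarrow> (nat \<Rightarrow> 'a::real_normed_vector) set" where
  "feasible d C\<^sub>2 k = {z. \<forall>i<k. \<forall>j<k. norm (z i - z j) \<ge> C\<^sub>2 * d i j}"

text \<open>Both \<open>distortion\<close> and \<open>feasible\<close> are invariant under translations, so a sequence of minimizers
  may escape to infinity and need not have a convergent subsequence. The convergence is therefore
  stated up to translations \<open>\<tau>\<close>, which are trivial unless the minimizers escape to infinity.\<close>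

definition embedding_limit ::
  "'a::real_normed_vector set \<Rightarrow> (nat \<Rightarrow> 'a) \<Rightarrow> real \<Rightarrow> real \<Rightarrow> (nat \<Rightarrow> nat \<Rightarrow> 'a) \<Rightarrow> bool" where
  "embedding_limit M y C\<^sub>1 \<epsilon> xs \<longleftrightarrow>
     (let d = (\<lambda>i j. gdist M (y i) (y j)) in
      \<exists>r \<tau> x. strict_mono (r :: nat \<Rightarrow> nat) \<and>
        (\<not> filterlim (\<lambda>k. xs k 0) at_infinity sequentially \<longrightarrow> \<tau> = (\<lambda>k. 0)) \<and>
        (\<forall>i. (\<lambda>k. xs (r k) i + \<tau> k) \<longlonglongrightarrow> x i) \<and>
        (\<forall>i j. d i j < \<epsilon> \<longrightarrow>
           d i j * (1 - 2 * C\<^sub>1 * \<epsilon>) \<le> norm (x i - x j) \<and>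
           norm (x i - x j) \<le> d i j * (1 + 2 * C\<^sub>1 * \<epsilon>)) \<and>
        (\<exists>f. continuous_on M f \<and> (\<forall>i. f (y i) = x i)) \<and>
        (\<forall>f. continuous_on M f \<and> (\<forall>i. f (y i) = x i) \<longrightarrow>
           (\<forall>i j. ereal (d i j * (1 - 2 * C\<^sub>1 * \<epsilon>)) \<le> geodesic_dist (f ` M) (x i) (x j) \<and>
                  geodesic_dist (f ` M) (x i) (x j) \<le> ereal (d i j * (1 + 2 * C\<^sub>1 * \<epsilon>)))))"

definition embedding_concl ::
  "'a::real_normed_vector set \<Rightarrow> (nat \<Rightarrow> 'a) \<Rightarrow> real \<Rightarrow> real \<Rightarrow> real \<Rightarrow> bool" where
  "embedding_concl M y \<epsilon>\<^sub>0 C\<^sub>1 C\<^sub>2 \<longleftrightarrow>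
     (let d = (\<lambda>i j. gdist M (y i) (y j)) in
      \<forall>\<epsilon> xs. 0 < \<epsilon> \<and> \<epsilon> < \<epsilon>\<^sub>0 \<and>
        (\<forall>k. is_arg_min (distortion d \<epsilon> k) (\<lambda>z. z \<in> feasible d C\<^sub>2 k) (xs k)) \<longrightarrow>
        embedding_limit M y C\<^sub>1 \<epsilon> xs)"

end

theory Submission
  imports Defs
begin

text \<open>The first half rests on one comparison. By the hypothesis on \<open>M\<close>, the data points themselves satisfy
the constraint and have distortion at most \<open>2 C\<^sub>1 \<epsilon>\<close>; hence so does every minimizer, and a bound
\<open>\<bar>|x\<^sub>i - x\<^sub>j|\<^sup>2 / d\<^sub>i\<^sub>j\<^sup>2 - 1\<bar> \<le> 2 C\<^sub>1 \<epsilon>\<close> gives the asserted two-sided estimate for \<open>|x\<^sub>i - x\<^sub>j|\<close>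
(\<open>minimizer_near_isometry\<close>). Since \<open>M\<close> is connected, any two data points are linked by a chain of
short steps, so the coordinates relative to the first point stay bounded, and compactness
yields a limit up to translation. The estimates and the constraint
\<open>|x\<^sub>i - x\<^sub>j| \<ge> C\<^sub>2 d\<^sub>i\<^sub>j\<close> pass to the limit and to the continuous extension \<open>f\<close>. Thus \<open>f\<close> is bi-Lipschitz, at
small scales with constants \<open>1 \<plusminus> 2 C\<^sub>1 \<epsilon>\<close>, and adding up over fine subdivisions carries these constants
over to lengths: the upper bound comes from mapping curves of \<open>M\<close> forward
(\<open>geodesic_dist_image_le\<close>), the lower bound from pulling curves of the image back along the inverse
of \<open>f\<close> (\<open>geodesic_dist_image_ge\<close>).

For a submanifold of reach \<open>\<alpha>\<close> the hypotheses follow from the estimate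
\<open>d\<^sub>M(a, b) \<le> 2 \<alpha> arcsin(|a - b| / (2 \<alpha>))\<close> for \<open>|a - b| < 2 \<alpha>\<close>, whose right-hand side is the length of the
circular arc of radius \<open>\<alpha>\<close> with the same chord (\<open>geodesic_dist_le_arc_bound\<close>). It holds for every
compact set of reach at least \<open>\<alpha>\<close>. A point of \<open>M\<close> that is nearest to some point of a ray issuing from it
stays nearest along the ray up to distance \<open>\<alpha>\<close> (\<open>nearest_ray_extends\<close>); this is a fixed-point
argument based on Brouwer's theorem. Consequently a ball of radius \<open>\<alpha>\<close> that touches \<open>M\<close> there contains no
point of \<open>M\<close> in its interior (\<open>reach_inner_bound\<close>). Therefore the projection to \<open>M\<close> of the
midpoint of \<open>a\<close> and \<open>b\<close> splits the pair into two pairs whose arcs together are no longer than the arc of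
\<open>a\<close> and \<open>b\<close> (\<open>arc_midpoint\<close>), and iterating the construction produces a curve in \<open>M\<close> of at most that
length (\<open>dyadic_curve\<close>).

What remains is that the reach is positive and finite. A \<open>C\<^sup>1\<^sup>,\<^sup>1\<close> submanifold deviates quadratically
from its tangent spaces (\<open>C11_normal_estimate\<close>), so two nearest points of a point close to \<open>M\<close>
coincide. Moreover, at a point of \<open>M\<close> farthest from the origin, both normal directions are available;
following the one towards the origin beyond it contradicts uniqueness of projections.\<close>

section \<open>Curve length\<close>

lemma dist_le_sum_consecutive:
  fixes g :: "nat \<Rightarrow> 'a::metric_space"
  assumes "m \<le> n"
  shows "dist (g m) (g n) \<le> (\<Sum>j=m..<n. dist (g j) (g (Suc j)))"
  using assms
proof (induction n rule: dec_induct)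
  case (step n)
  have "dist (g m) (g (Suc n)) \<le> dist (g m) (g n) + dist (g n) (g (Suc n))"
    by (rule dist_triangle)
  with step show ?case by simp
qed simp

text \<open>The monotonicity \<open>a 0 \<le> a N\<close> is part of the conclusion because the induction needs it.\<close>

lemma sum_dist_subsequence_le:
  fixes g :: "nat \<Rightarrow> 'a::metric_space" and a :: "nat \<Rightarrow> nat"
  assumes "\<And>i. i < N \<Longrightarrow> a i \<le> a (Suc i)"
  shows "(\<Sum>i<N. dist (g (a i)) (g (a (Suc i)))) \<le> (\<Sum>j=a 0..<a N. dist (g j) (g (Suc j)))
         \<and> a 0 \<le> a N"
  using assms
proof (induction N)
  case (Suc N)
  then have IH: "(\<Sum>i<N. dist (g (a i)) (g (a (Suc i)))) \<le> (\<Sum>j=a 0..<a N. dist (g j) (g (Suc j)))"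
    and le: "a 0 \<le> a N" "a N \<le> a (Suc N)" by auto
  have "(\<Sum>j=a 0..<a N. dist (g j) (g (Suc j))) + (\<Sum>j=a N..<a (Suc N). dist (g j) (g (Suc j)))
        = (\<Sum>j=a 0..<a (Suc N). dist (g j) (g (Suc j)))"
    using le by (intro sum.atLeastLessThan_concat)
  with IH dist_le_sum_consecutive[OF le(2), of g] le show ?case by auto
qed simp

definition grid_length :: "(real \<Rightarrow> 'a::metric_space) \<Rightarrow> nat \<Rightarrow> real" where
  "grid_length g m = (\<Sum>j<m. dist (g (real j / real m)) (g (real (Suc j) / real m)))"

lemma grid_length_le_curve_length:
  assumes "m > 0"
  shows "ereal (grid_length g m) \<le> curve_length g"
  unfolding curve_length_def grid_length_def
  by (intro Sup_upper CollectI exI[of _ m] exI[of _ "\<lambda>i. real i / real m"])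
     (use assms in \<open>auto simp: divide_right_mono\<close>)

lemma dist_le_curve_length:
  "ereal (dist (pathstart g) (pathfinish g)) \<le> curve_length g"
  using grid_length_le_curve_length[of 1 g]
  by (simp add: grid_length_def pathstart_def pathfinish_def)

lemma curve_length_nonneg: "0 \<le> curve_length g"
  using dist_le_curve_length[of g] by (meson ereal_less_eq(5) order_trans zero_le_dist)

text \<open>For a continuous curve, uniform subdivisions suffice: rounding the nodes of an arbitrary
subdivision down to multiples of \<open>1/m\<close> changes its sum by a quantity that vanishes as \<open>m\<close> grows, and
the rounded sum is at most the sum over the whole grid. It is enough to control arbitrarily large
\<open>m\<close>, which leaves the freedom to use only even or only dyadic grids.\<close>

lemma curve_length_le_of_grid:
  fixes g :: "real \<Rightarrow> 'a::metric_space"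
  assumes g: "path g"
    and grid: "\<And>\<delta> m\<^sub>0. \<delta> > 0 \<Longrightarrow> \<exists>m\<ge>m\<^sub>0. grid_length g m \<le> L + \<delta>"
  shows "curve_length g \<le> ereal L"
  unfolding curve_length_def
proof (rule Sup_least, clarify)
  fix N :: nat and t :: "nat \<Rightarrow> real"
  assume t0: "t 0 = 0" and tN: "t N = 1" and mono: "\<forall>i<N. t i \<le> t (Suc i)"
  have mono': "t i \<le> t j" if "i \<le> j" "j \<le> N" for i j
    using that
  proof (induction j rule: dec_induct)
    case (step n)
    then have "t i \<le> t n" "t n \<le> t (Suc n)" using mono by auto
    then show ?case by (rule order_trans)
  qed simp
  have t01: "0 \<le> t i" "t i \<le> 1" if "i \<le> N" for i
    using mono'[of 0 i] mono'[of i N] that t0 tN by auto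
  define a where "a = (\<lambda>m i. nat \<lfloor>real m * t i\<rfloor>)"
  define S where "S = (\<lambda>m. \<Sum>i<N. dist (g (real (a m i) / real m)) (g (real (a m (Suc i)) / real m)))"
  let ?V = "\<Sum>i<N. dist (g (t i)) (g (t (Suc i)))"
  have a_lim: "(\<lambda>m. real (a m i) / real m) \<longlonglongrightarrow> t i" if "i \<le> N" for i
  proof -
    have "(\<lambda>m. inverse (real m)) \<longlonglongrightarrow> 0" by (rule lim_inverse_n)
    then show ?thesis
    proof (rule metric_tendsto_imp_tendsto)
      show "\<forall>\<^sub>F m in sequentially. dist (real (a m i) / real m) (t i) \<le> dist (inverse (real m)) 0"
      proof (intro eventually_sequentiallyI[of 1])
        fix m :: nat assume m: "1 \<le> m"
        have "0 \<le> real m * t i" using t01[OF that] by simp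
        then have "real (a m i) = of_int \<lfloor>real m * t i\<rfloor>"
          unfolding a_def by simp
        then have "real (a m i) \<le> real m * t i" "real m * t i < real (a m i) + 1"
          by linarith+
        then have "\<bar>real (a m i) - real m * t i\<bar> \<le> 1" by linarith
        then have "\<bar>real (a m i) - real m * t i\<bar> / real m \<le> 1 / real m"
          by (rule divide_right_mono) simp
        moreover have "real (a m i) / real m - t i = (real (a m i) - real m * t i) / real m"
          using m by (simp add: field_simps)
        ultimately show "dist (real (a m i) / real m) (t i) \<le> dist (inverse (real m)) 0"
          by (simp add: dist_real_def inverse_eq_divide)
      qed
    qed
  qed
  have a_le: "a m i \<le> m" if "i \<le> N" for m i
  proof -
    have "real m * t i \<le> real m" using t01[OF that] by (simp add: mult_left_le)
    then show ?thesis unfolding a_def by linarith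
  qed
  have g_lim: "(\<lambda>m. g (real (a m i) / real m)) \<longlonglongrightarrow> g (t i)" if "i \<le> N" for i
  proof (rule continuous_on_tendsto_compose[OF _ a_lim[OF that]])
    show "continuous_on {0..1} g" using g by (simp add: path_def)
    show "t i \<in> {0..1}" using t01[OF that] by simp
    show "\<forall>\<^sub>F m in sequentially. real (a m i) / real m \<in> {0..1}"
      using a_le[OF that] by (intro always_eventually) (auto simp: divide_le_eq_1)
  qed
  have S_lim: "S \<longlonglongrightarrow> ?V"
    unfolding S_def by (intro tendsto_sum tendsto_dist g_lim) auto
  have S_le: "S m \<le> grid_length g m" for m
  proof -
    have "a m i \<le> a m (Suc i)" if "i < N" for i
      unfolding a_def using mono that by (intro nat_mono floor_mono mult_left_mono) auto
    then have "S m \<le> (\<Sum>j=a m 0..<a m N. dist (g (real j / real m)) (g (real (Suc j) / real m)))"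
      unfolding S_def using sum_dist_subsequence_le[of N "a m" "\<lambda>j. g (real j / real m)"] by blast
    also have "\<dots> = grid_length g m"
      by (simp add: a_def t0 tN grid_length_def atLeast0LessThan)
    finally show ?thesis .
  qed
  have "?V \<le> L"
  proof (rule ccontr)
    assume "\<not> ?V \<le> L"
    then have pos: "(?V - L) / 2 > 0" and "L + (?V - L) / 2 < ?V" by (auto simp: field_simps)
    then have "\<forall>\<^sub>F m in sequentially. L + (?V - L) / 2 < S m"
      using S_lim order_tendstoD(1) by blast
    then obtain m\<^sub>0 where m0: "\<And>m. m \<ge> m\<^sub>0 \<Longrightarrow> L + (?V - L) / 2 < S m"
      by (auto simp: eventually_sequentially)
    obtain m where "m \<ge> m\<^sub>0" "grid_length g m \<le> L + (?V - L) / 2"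
      using grid[OF pos] by blast
    with m0 S_le show False by (meson not_less order_trans)
  qed
  then show "ereal ?V \<le> ereal L" by simp
qed

lemma path_grid_fine:
  fixes g :: "real \<Rightarrow> 'a::metric_space"
  assumes "path g" "0 < \<rho>"
  shows "\<exists>m\<^sub>1. \<forall>m\<ge>m\<^sub>1. \<forall>j<m. dist (g (real j / real m)) (g (real (Suc j) / real m)) < \<rho>"
proof -
  have "uniformly_continuous_on {0..1} g"
    using assms(1) by (intro compact_uniformly_continuous) (auto simp: path_def)
  then obtain \<sigma> where \<sigma>: "\<sigma> > 0" "\<And>s t. s \<in> {0..1} \<Longrightarrow> t \<in> {0..1} \<Longrightarrow> dist t s < \<sigma> \<Longrightarrow> dist (g t) (g s) < \<rho>"
    unfolding uniformly_continuous_on_def using \<open>0 < \<rho>\<close> by meson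
  obtain m\<^sub>1 where m1: "inverse (real (Suc m\<^sub>1)) < \<sigma>" using \<sigma>(1) reals_Archimedean by blast
  show ?thesis
  proof (intro exI[of _ "Suc m\<^sub>1"] allI impI)
    fix m j assume m: "Suc m\<^sub>1 \<le> m" and j: "j < m"
    have "dist (real j / real m) (real (Suc j) / real m) = inverse (real m)"
      using j by (simp add: dist_real_def field_simps)
    also have "\<dots> \<le> inverse (real (Suc m\<^sub>1))" using m by (intro le_imp_inverse_le) auto
    also note m1
    finally show "dist (g (real j / real m)) (g (real (Suc j) / real m)) < \<rho>"
      using j by (intro \<sigma>(2)) auto
  qed
qed

text \<open>The parameter \<open>1/2\<close> at which the two curves are glued is a node of every even grid.\<close>

lemma grid_length_join:
  assumes "pathfinish g = pathstart h" "p > 0"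
  shows "grid_length (g +++ h) (2 * p) = grid_length g p + grid_length h p"
proof -
  let ?F = "\<lambda>j. dist ((g +++ h) (real j / real (2*p))) ((g +++ h) (real (Suc j) / real (2*p)))"
  have "grid_length (g +++ h) (2 * p) = (\<Sum>j=0..<p + p. ?F j)"
    unfolding grid_length_def atLeast0LessThan mult_2 by (rule refl)
  also have "\<dots> = (\<Sum>j=0..<p. ?F j) + (\<Sum>j=p..<p+p. ?F j)"
    by (rule sum.atLeastLessThan_concat[symmetric]) auto
  also have "(\<Sum>j=p..<p+p. ?F j) = (\<Sum>j=0..<p. ?F (j + p))"
    using sum.shift_bounds_nat_ivl[of ?F 0 p p] unfolding add_0 .
  also have "(\<Sum>j=0..<p. ?F (j + p)) = grid_length h p"
  proof -
    have *: "(g +++ h) (real (j + p) / real (2*p)) = h (real j / real p)" if "j \<le> p" for j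
    proof (cases "j = 0")
      case True
      then show ?thesis using assms by (simp add: joinpaths_def pathfinish_def pathstart_def)
    next
      case False
      have "2 * (real (j + p) / real (2*p)) - 1 = real j / real p"
        using assms by (simp add: field_simps)
      moreover have "\<not> real (j + p) / real (2*p) \<le> 1/2"
        using assms False by (simp add: field_simps)
      ultimately show ?thesis by (simp only: joinpaths_def if_False)
    qed
    show ?thesis unfolding grid_length_def atLeast0LessThan
      using *[OF less_imp_le] *[OF Suc_leI] by (intro sum.cong) (auto simp del: of_nat_Suc)
  qed
  also have "(\<Sum>j=0..<p. ?F j) = grid_length g p"
  proof -
    have *: "(g +++ h) (real j / real (2*p)) = g (real j / real p)" if "j \<le> p" for j
      using assms that by (simp add: joinpaths_def field_simps)
    show ?thesis unfolding grid_length_def atLeast0LessThan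
      using *[OF less_imp_le] *[OF Suc_leI] by (intro sum.cong) (auto simp del: of_nat_Suc)
  qed
  finally show ?thesis .
qed

lemma curve_length_join_le:
  assumes "path g" "path h" "pathfinish g = pathstart h"
  shows "curve_length (g +++ h) \<le> curve_length g + curve_length h"
proof (cases "curve_length g = \<infinity> \<or> curve_length h = \<infinity>")
  case True
  then show ?thesis by auto
next
  case False
  then obtain A B where AB: "curve_length g = ereal A" "curve_length h = ereal B"
    using curve_length_nonneg[of g] curve_length_nonneg[of h]
    by (metis ereal_cases ereal_infty_less_eq(2) ereal_less_eq(4) not_MInfty_nonneg)
  have "curve_length (g +++ h) \<le> ereal (A + B)"
  proof (rule curve_length_le_of_grid)
    show "path (g +++ h)" using assms by simp
    fix \<delta> :: real and m\<^sub>0 :: nat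
    assume "\<delta> > 0"
    have "grid_length g (Suc m\<^sub>0) \<le> A" "grid_length h (Suc m\<^sub>0) \<le> B"
      using AB grid_length_le_curve_length[of "Suc m\<^sub>0" g] grid_length_le_curve_length[of "Suc m\<^sub>0" h] by auto
    then have "grid_length (g +++ h) (2 * Suc m\<^sub>0) \<le> A + B + \<delta>"
      using grid_length_join[OF assms(3), of "Suc m\<^sub>0"] \<open>\<delta> > 0\<close> by simp
    then show "\<exists>m\<ge>m\<^sub>0. grid_length (g +++ h) m \<le> A + B + \<delta>"
      by (intro exI[of _ "2 * Suc m\<^sub>0"]) auto
  qed
  with AB show ?thesis by simp
qed

lemma grid_length_reversepath: "grid_length (reversepath g) m = grid_length g m"
proof -
  have "grid_length (reversepath g) m
        = (\<Sum>j<m. dist (g (real (m - j) / real m)) (g (real (m - Suc j) / real m)))"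
    unfolding grid_length_def reversepath_def
    by (intro sum.cong refl arg_cong2[where f=dist] arg_cong[of _ _ g]) (auto simp: field_simps of_nat_diff)
  also have "\<dots> = (\<Sum>j<m. dist (g (real (m - (m - Suc j)) / real m)) (g (real (m - Suc (m - Suc j)) / real m)))"
    by (rule sum.nat_diff_reindex[symmetric])
  also have "\<dots> = grid_length g m"
    unfolding grid_length_def
    by (intro sum.cong refl) (auto simp: dist_commute Suc_diff_Suc simp del: of_nat_Suc)
  finally show ?thesis .
qed

lemma curve_length_reversepath_le:
  assumes "path g"
  shows "curve_length (reversepath g) \<le> curve_length g"
proof (cases "curve_length g")
  case (real A)
  have "curve_length (reversepath g) \<le> ereal A"
  proof (rule curve_length_le_of_grid)
    show "path (reversepath g)" using assms by simp
    fix \<delta> :: real and m\<^sub>0 :: nat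
    assume "\<delta> > 0"
    then show "\<exists>m\<ge>m\<^sub>0. grid_length (reversepath g) m \<le> A + \<delta>"
      using real grid_length_le_curve_length[of "Suc m\<^sub>0" g]
      by (intro exI[of _ "Suc m\<^sub>0"]) (auto simp: grid_length_reversepath)
  qed
  with real show ?thesis by simp
qed (use curve_length_nonneg[of g] in auto)

section \<open>Geodesic distance\<close>

lemma geodesic_dist_le_curve_length:
  assumes "path \<theta>" "path_image \<theta> \<subseteq> S" "pathstart \<theta> = u" "pathfinish \<theta> = v"
  shows "geodesic_dist S u v \<le> curve_length \<theta>"
  unfolding geodesic_dist_def by (rule Inf_lower) (use assms in blast)

lemma dist_le_geodesic_dist: "ereal (dist u v) \<le> geodesic_dist S u v"
  unfolding geodesic_dist_def using dist_le_curve_length by (intro Inf_greatest) blast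

lemma geodesic_dist_nonneg: "0 \<le> geodesic_dist S u v"
  using dist_le_geodesic_dist[of u v S] by (meson ereal_less_eq(5) order_trans zero_le_dist)

lemma geodesic_dist_self:
  assumes "u \<in> S"
  shows "geodesic_dist S u u = 0"
proof (rule antisym[OF _ geodesic_dist_nonneg])
  have "curve_length (\<lambda>_::real. u) \<le> ereal 0"
    by (rule curve_length_le_of_grid) (auto simp: path_def grid_length_def)
  then show "geodesic_dist S u u \<le> 0"
    using geodesic_dist_le_curve_length[of "\<lambda>_. u" S u u] assms
    by (auto simp: path_def path_image_def pathstart_def pathfinish_def zero_ereal_def)
qed

lemma geodesic_dist_triangle:
  "geodesic_dist S u w \<le> geodesic_dist S u v + geodesic_dist S v w"
proof (rule ccontr)
  assume "\<not> ?thesis"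
  then have less: "geodesic_dist S u v + geodesic_dist S v w < geodesic_dist S u w" by simp
  have nn: "geodesic_dist S u v \<noteq> -\<infinity>" "geodesic_dist S v w \<noteq> -\<infinity>"
    using geodesic_dist_nonneg[of S u v] geodesic_dist_nonneg[of S v w] by auto
  have fin: "geodesic_dist S u v \<noteq> \<infinity>" "geodesic_dist S v w \<noteq> \<infinity>"
    using less nn by auto
  obtain A B where AB: "geodesic_dist S u v = ereal A" "geodesic_dist S v w = ereal B"
    using nn fin by (metis ereal_cases)
  obtain c where c: "ereal (A + B) < ereal c" "ereal c < geodesic_dist S u w"
    using less AB by (metis ereal_dense2 plus_ereal.simps(1))
  define \<delta> where "\<delta> = (c - (A + B)) / 2"
  have \<delta>: "\<delta> > 0" "c = (A + \<delta>) + (B + \<delta>)" using c by (auto simp: \<delta>_def field_simps)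
  have "geodesic_dist S u v < ereal (A + \<delta>)" "geodesic_dist S v w < ereal (B + \<delta>)"
    using AB \<delta> by auto
  then obtain g h where
    g: "path g" "path_image g \<subseteq> S" "pathstart g = u" "pathfinish g = v" "curve_length g < ereal (A + \<delta>)" and
    h: "path h" "path_image h \<subseteq> S" "pathstart h = v" "pathfinish h = w" "curve_length h < ereal (B + \<delta>)"
    unfolding geodesic_dist_def by (auto simp: Inf_less_iff)
  have "geodesic_dist S u w \<le> curve_length (g +++ h)"
    using g h by (intro geodesic_dist_le_curve_length) (auto simp: path_image_join)
  also have "\<dots> \<le> curve_length g + curve_length h"
    using g h by (intro curve_length_join_le) auto
  also have "\<dots> \<le> ereal (A + \<delta>) + ereal (B + \<delta>)"
    using g(5) h(5) by (intro add_mono) auto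
  also have "\<dots> = ereal c" using \<delta> by simp
  finally show False using c by simp
qed

lemma geodesic_dist_commute: "geodesic_dist S u v = geodesic_dist S v u"
proof -
  have "geodesic_dist S u v \<le> geodesic_dist S v u" for u v
    unfolding geodesic_dist_def[of S v u]
  proof (rule Inf_greatest, clarify)
    fix \<theta> :: "real \<Rightarrow> 'a"
    assume "path \<theta>" "path_image \<theta> \<subseteq> S" "u = pathfinish \<theta>" "v = pathstart \<theta>"
    then have "geodesic_dist S u v \<le> curve_length (reversepath \<theta>)"
      by (intro geodesic_dist_le_curve_length) auto
    also have "\<dots> \<le> curve_length \<theta>" by (rule curve_length_reversepath_le) fact
    finally show "geodesic_dist S (pathfinish \<theta>) (pathstart \<theta>) \<le> curve_length \<theta>"
      using \<open>u = _\<close> \<open>v = _\<close> by simp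
  qed
  then show ?thesis by (intro antisym)
qed

context
  fixes S :: "'a::metric_space set"
  assumes S: "rectifiably_connected S"
begin

lemma geodesic_dist_eq_gdist:
  assumes "u \<in> S" "v \<in> S"
  shows "geodesic_dist S u v = ereal (gdist S u v)"
proof -
  obtain \<theta> where "path \<theta>" "path_image \<theta> \<subseteq> S" "pathstart \<theta> = u" "pathfinish \<theta> = v"
    "curve_length \<theta> < \<infinity>"
    using S assms unfolding rectifiably_connected_def by blast
  then have "geodesic_dist S u v < \<infinity>"
    using geodesic_dist_le_curve_length by (meson order.strict_trans1)
  then show ?thesis
    unfolding gdist_def using geodesic_dist_nonneg[of S u v] by (auto simp: ereal_real)
qed

lemma dist_le_gdist: "u \<in> S \<Longrightarrow> v \<in> S \<Longrightarrow> dist u v \<le> gdist S u v"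
  using dist_le_geodesic_dist[of u v S] by (simp add: geodesic_dist_eq_gdist)

lemma gdist_nonneg: "u \<in> S \<Longrightarrow> v \<in> S \<Longrightarrow> 0 \<le> gdist S u v"
  using dist_le_gdist[of u v] zero_le_dist[of u v] by linarith

lemma gdist_pos: "u \<in> S \<Longrightarrow> v \<in> S \<Longrightarrow> u \<noteq> v \<Longrightarrow> 0 < gdist S u v"
  using dist_le_gdist[of u v] zero_less_dist_iff[of u v] by linarith

lemma gdist_self: "u \<in> S \<Longrightarrow> gdist S u u = 0"
  by (simp add: gdist_def geodesic_dist_self)

lemma gdist_triangle:
  "u \<in> S \<Longrightarrow> v \<in> S \<Longrightarrow> w \<in> S \<Longrightarrow> gdist S u w \<le> gdist S u v + gdist S v w"
  using geodesic_dist_triangle[of S u w v] by (simp add: geodesic_dist_eq_gdist)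

lemma gdist_commute: "gdist S u v = gdist S v u"
  by (simp add: gdist_def geodesic_dist_commute)

lemma gdist_le_sum_consecutive:
  assumes "\<And>j. j \<le> n \<Longrightarrow> p j \<in> S"
  shows "gdist S (p 0) (p n) \<le> (\<Sum>j<n. gdist S (p j) (p (Suc j)))"
  using assms
proof (induction n)
  case 0
  then show ?case by (simp add: gdist_self)
next
  case (Suc n)
  have "gdist S (p 0) (p (Suc n)) \<le> gdist S (p 0) (p n) + gdist S (p n) (p (Suc n))"
    using Suc.prems by (intro gdist_triangle) auto
  with Suc show ?case by force
qed

end

section \<open>Bounded and convergent configurations\<close>

text \<open>The balls of radius \<open>\<delta>/2\<close> around the points with property \<open>P\<close> and around those without it are
disjoint on \<open>M\<close> and cover it, so connectedness forbids that both occur. This replaces explicit chains of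
short steps from one data point to another.\<close>

lemma connected_dense_chain_induct:
  fixes y :: "nat \<Rightarrow> 'a::metric_space"
  assumes conn: "connected M" and yM: "range y \<subseteq> M" and dense: "M \<subseteq> closure (range y)" and "0 < \<delta>"
    and base: "P i\<^sub>0" and step: "\<And>i j. P i \<Longrightarrow> dist (y i) (y j) < \<delta> \<Longrightarrow> P j"
  shows "P i"
proof (rule ccontr)
  assume "\<not> P i"
  define U where "U = (\<lambda>Q. \<Union>i\<in>{i. Q i}. ball (y i) (\<delta> / 2))"
  have "open (U Q)" for Q unfolding U_def by auto
  moreover have "M \<subseteq> U P \<union> U (\<lambda>i. \<not> P i)"
  proof
    fix z assume "z \<in> M"
    then obtain j where "dist (y j) z < \<delta> / 2"
      using dense closure_approachable[of z "range y"] \<open>0 < \<delta>\<close> by (auto dest!: spec[of _ "\<delta> / 2"])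
    then show "z \<in> U P \<union> U (\<lambda>i. \<not> P i)" unfolding U_def by auto
  qed
  moreover have "U P \<inter> U (\<lambda>i. \<not> P i) \<inter> M = {}"
  proof -
    have False if "P a" "\<not> P b" "z \<in> ball (y a) (\<delta>/2)" "z \<in> ball (y b) (\<delta>/2)" for a b z
    proof -
      have "dist (y a) (y b) \<le> dist (y a) z + dist (y b) z" by (rule dist_triangle2)
      with that have "dist (y a) (y b) < \<delta>" by simp
      with step that show False by blast
    qed
    then show ?thesis unfolding U_def by blast
  qed
  moreover have "y i\<^sub>0 \<in> U P \<inter> M" "y i \<in> U (\<lambda>i. \<not> P i) \<inter> M"
    using base \<open>\<not> P i\<close> yM \<open>0 < \<delta>\<close> by (auto simp: U_def)
  ultimately show False using conn unfolding connected_def by blast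
qed

lemma rectifiably_connected_imp_connected:
  assumes "rectifiably_connected S"
  shows "connected S"
proof -
  have "path_connected S"
    using assms unfolding rectifiably_connected_def path_connected_def by blast
  then show ?thesis by (rule path_connected_imp_connected)
qed

text \<open>Tychonoff's theorem for a countable product of balls, whose topology is metrizable.\<close>

lemma bounded_coordinates_convergent_subsequence:
  fixes w :: "nat \<Rightarrow> nat \<Rightarrow> 'a::euclidean_space"
  assumes "\<And>i. \<exists>B. \<forall>\<^sub>F k in sequentially. norm (w k i) \<le> B"
  shows "\<exists>r x. strict_mono (r :: nat \<Rightarrow> nat) \<and> (\<forall>i. (\<lambda>k. w (r k) i) \<longlonglongrightarrow> x i)"
proof -
  have "\<exists>B>0. \<forall>k. norm (w k i) \<le> B" for i
  proof -
    have "Bseq (\<lambda>k. w k i)"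
      using assms[of i] unfolding Bseq_eq_bounded[symmetric] by (auto intro: BfunI)
    then show ?thesis by (auto simp: Bseq_def)
  qed
  then obtain B where B: "\<And>i k. norm (w k i) \<le> B i" by metis
  let ?K = "PiE UNIV (\<lambda>i. cball (0::'a) (B i))"
  have "compactin (product_topology (\<lambda>i::nat. euclidean) UNIV) ?K"
    by (simp add: compactin_PiE)
  then have "compact ?K"
    by (simp add: euclidean_product_topology compactin_euclidean_iff)
  moreover have "\<forall>k. w k \<in> ?K" using B by auto
  ultimately obtain x r where r: "strict_mono (r :: nat \<Rightarrow> nat)" and lim: "(w \<circ> r) \<longlonglongrightarrow> x"
    unfolding compact_def by meson
  have "(\<lambda>k. w (r k) i) \<longlonglongrightarrow> x i" for i
    using continuous_on_tendsto_compose[OF continuous_on_product_coordinates[of i] lim] by simp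
  with r show ?thesis by blast
qed

text \<open>If the first points do not tend to infinity, some subsequence of them is bounded, and then no
translation is necessary. Otherwise the first point is translated to the origin.\<close>

lemma convergent_subsequence_up_to_translation:
  fixes xs :: "nat \<Rightarrow> nat \<Rightarrow> 'a::euclidean_space"
  assumes "\<And>i. \<exists>B. \<forall>\<^sub>F k in sequentially. norm (xs k i - xs k 0) \<le> B"
  shows "\<exists>r \<tau> x. strict_mono (r :: nat \<Rightarrow> nat) \<and>
        (\<not> filterlim (\<lambda>k. xs k 0) at_infinity sequentially \<longrightarrow> \<tau> = (\<lambda>k. 0)) \<and>
        (\<forall>i. (\<lambda>k. xs (r k) i + \<tau> k) \<longlonglongrightarrow> x i)"
proof (cases "filterlim (\<lambda>k. xs k 0) at_infinity sequentially")
  case True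
  obtain r x where "strict_mono (r :: nat \<Rightarrow> nat)" "\<And>i. (\<lambda>k. xs (r k) i - xs (r k) 0) \<longlonglongrightarrow> x i"
    using bounded_coordinates_convergent_subsequence[of "\<lambda>k i. xs k i - xs k 0"] assms by auto
  with True show ?thesis
    by (intro exI[of _ r] exI[of _ "\<lambda>k. - xs (r k) 0"] exI[of _ x]) auto
next
  case False
  then obtain b where b: "\<exists>\<^sub>F k in sequentially. norm (xs k 0) \<le> b"
    unfolding filterlim_at_infinity[OF order_refl] frequently_def
    by (metis (mono_tags, lifting) eventually_mono linear)
  obtain s :: "nat \<Rightarrow> nat" where s: "strict_mono s" "\<And>n. norm (xs (s n) 0) \<le> b"
    using b infinite_enumerate[of "{k. norm (xs k 0) \<le> b}"]
    by (auto simp: frequently_cofinite cofinite_eq_sequentially[symmetric])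
  have "\<exists>B. \<forall>\<^sub>F k in sequentially. norm (xs (s k) i) \<le> B" for i
  proof -
    obtain B where "\<forall>\<^sub>F k in sequentially. norm (xs k i - xs k 0) \<le> B" using assms by blast
    then have "\<forall>\<^sub>F k in sequentially. norm (xs (s k) i - xs (s k) 0) \<le> B"
      using eventually_subseq[OF s(1)] by blast
    then have "\<forall>\<^sub>F k in sequentially. norm (xs (s k) i) \<le> B + b"
    proof eventually_elim
      case (elim k)
      with norm_triangle_sub[of "xs (s k) i" "xs (s k) 0"] s(2)[of k] show ?case by linarith
    qed
    then show ?thesis by blast
  qed
  then obtain r x where r: "strict_mono (r :: nat \<Rightarrow> nat)" "\<And>i. (\<lambda>k. xs (s (r k)) i) \<longlonglongrightarrow> x i"
    using bounded_coordinates_convergent_subsequence[of "\<lambda>k. xs (s k)"] by auto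
  have "strict_mono (s \<circ> r)" using s(1) r(1) by (rule strict_mono_o)
  with False r(2) show ?thesis
    by (intro exI[of _ "s \<circ> r"] exI[of _ "\<lambda>k. 0"] exI[of _ x]) auto
qed

section \<open>Distortion of the data points and of minimizers\<close>

lemma finite_distortion_set:
  "finite {h i j | i j. i < k \<and> j < k \<and> P i j}" for k :: nat
  by (rule finite_subset[of _ "(\<lambda>(i, j). h i j) ` ({..<k} \<times> {..<k})"]) auto

lemma distortion_le:
  assumes "0 \<le> L"
    and "\<And>i j. i < k \<Longrightarrow> j < k \<Longrightarrow> i \<noteq> j \<Longrightarrow> d i j < \<epsilon> \<Longrightarrow> \<bar>(norm (z i - z j))\<^sup>2 / (d i j)\<^sup>2 - 1\<bar> \<le> L"
  shows "distortion d \<epsilon> k z \<le> L"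
  unfolding distortion_def Let_def
  using assms finite_distortion_set[of "\<lambda>i j. \<bar>(norm (z i - z j))\<^sup>2 / (d i j)\<^sup>2 - 1\<bar>" k "\<lambda>i j. i \<noteq> j \<and> d i j < \<epsilon>"]
  by (auto simp: Max_le_iff)

lemma le_distortion:
  assumes "i < k" "j < k" "i \<noteq> j" "d i j < \<epsilon>"
  shows "\<bar>(norm (z i - z j))\<^sup>2 / (d i j)\<^sup>2 - 1\<bar> \<le> distortion d \<epsilon> k z"
proof -
  let ?A = "{\<bar>(norm (z i - z j))\<^sup>2 / (d i j)\<^sup>2 - 1\<bar> | i j. i < k \<and> j < k \<and> i \<noteq> j \<and> d i j < \<epsilon>}"
  have "finite ?A" by (rule finite_distortion_set)
  moreover have *: "\<bar>(norm (z i - z j))\<^sup>2 / (d i j)\<^sup>2 - 1\<bar> \<in> ?A" using assms by blast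
  ultimately have "\<bar>(norm (z i - z j))\<^sup>2 / (d i j)\<^sup>2 - 1\<bar> \<le> Max ?A" by (rule Max_ge)
  moreover have "?A \<noteq> {}" using * by blast
  ultimately show ?thesis unfolding distortion_def Let_def by (simp only: if_False)
qed

context
  fixes M :: "'a::euclidean_space set" and \<epsilon>\<^sub>0 C\<^sub>1 C\<^sub>2 :: real
  assumes M: "embedding_assms M \<epsilon>\<^sub>0 C\<^sub>1 C\<^sub>2"
begin

lemma rectifiably_connected_M: "rectifiably_connected M"
  and eps0_pos: "0 < \<epsilon>\<^sub>0" and C1_pos: "0 < C\<^sub>1" and C2_pos: "0 < C\<^sub>2"
  and gdist_upper: "\<And>u v. u \<in> M \<Longrightarrow> v \<in> M \<Longrightarrow> gdist M u v \<le> \<epsilon>\<^sub>0 \<Longrightarrow>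
        gdist M u v \<le> norm (u - v) + C\<^sub>1 * (norm (u - v))\<^sup>2"
  using M unfolding embedding_assms_def by auto

lemmas M_dist_le_gdist = dist_le_gdist[OF rectifiably_connected_M]
  and M_gdist_nonneg = gdist_nonneg[OF rectifiably_connected_M]
  and M_gdist_pos = gdist_pos[OF rectifiably_connected_M]
  and M_gdist_self = gdist_self[OF rectifiably_connected_M]
  and M_gdist_triangle = gdist_triangle[OF rectifiably_connected_M]
  and M_gdist_commute = gdist_commute[OF rectifiably_connected_M]

lemma C2_gdist_le_dist:
  assumes "u \<in> M" "v \<in> M"
  shows "C\<^sub>2 * gdist M u v \<le> dist u v"
proof (cases "u = v")
  case False
  let ?Q = "{norm (x - y) / gdist M x y | x y. x \<in> M \<and> y \<in> M \<and> x \<noteq> y}"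
  have "C2_bar M \<le> norm (u - v) / gdist M u v"
    unfolding C2_bar_def
  proof (rule cInf_lower)
    show "bdd_below ?Q" using M_gdist_nonneg by (intro bdd_belowI[of _ 0]) auto
  qed (use assms False in blast)
  then have "C\<^sub>2 \<le> norm (u - v) / gdist M u v"
    using M by (simp add: embedding_assms_def)
  with M_gdist_pos[OF assms False] show ?thesis
    by (simp add: field_simps dist_norm)
qed (use assms in \<open>simp add: M_gdist_self\<close>)

lemma gdist_le_dist_C2:
  assumes "u \<in> M" "v \<in> M"
  shows "gdist M u v \<le> dist u v / C\<^sub>2"
  using C2_gdist_le_dist[OF assms] C2_pos by (simp add: field_simps)

lemma gdist_less_of_dist_less:
  assumes "u \<in> M" "v \<in> M" "dist u v < C\<^sub>2 * \<epsilon>"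
  shows "gdist M u v < \<epsilon>"
proof -
  have "C\<^sub>2 * gdist M u v < C\<^sub>2 * \<epsilon>" using C2_gdist_le_dist[of u v] assms by linarith
  then show ?thesis using C2_pos by simp
qed

text \<open>The ratio of chord to geodesic distance is at least \<open>1 / (1 + c)\<close> with \<open>c = C\<^sub>1 \<epsilon>\<close>, and
\<open>(1 - 2 c) (1 + c)\<^sup>2 = 1 - 3 c\<^sup>2 - 2 c\<^sup>3 \<le> 1\<close>.\<close>

lemma dist_over_gdist_near_1:
  assumes "u \<in> M" "v \<in> M" "u \<noteq> v" "gdist M u v < \<epsilon>" "\<epsilon> \<le> \<epsilon>\<^sub>0"
  shows "\<bar>(norm (u - v))\<^sup>2 / (gdist M u v)\<^sup>2 - 1\<bar> \<le> 2 * (C\<^sub>1 * \<epsilon>)"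
proof -
  let ?d = "gdist M u v" and ?r = "norm (u - v)" and ?c = "C\<^sub>1 * \<epsilon>"
  have r: "0 < ?r" using assms by simp
  have rd: "?r \<le> ?d" using M_dist_le_gdist[of u v] assms by (simp add: dist_norm)
  have "0 < \<epsilon>" using rd r assms(4) by linarith
  then have c: "0 \<le> ?c" using C1_pos by simp
  have "?d \<le> ?r + C\<^sub>1 * ?r\<^sup>2" using assms gdist_upper by simp
  also have "\<dots> = ?r * (1 + C\<^sub>1 * ?r)" by (simp add: power2_eq_square algebra_simps)
  also have "\<dots> \<le> ?r * (1 + ?c)"
    using r rd assms(4) C1_pos by (intro mult_left_mono add_left_mono) auto
  finally have "?d\<^sup>2 \<le> (?r * (1 + ?c))\<^sup>2" using M_gdist_nonneg assms by (intro power_mono) auto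
  then have d2: "?d\<^sup>2 \<le> ?r\<^sup>2 * (1 + ?c)\<^sup>2" by (simp add: power_mult_distrib)
  have "(1 - 2 * ?c) * ?d\<^sup>2 \<le> ?r\<^sup>2"
  proof (cases "1 - 2 * ?c \<le> 0")
    case True
    then have "(1 - 2 * ?c) * ?d\<^sup>2 \<le> 0" by (intro mult_nonpos_nonneg) auto
    then show ?thesis by (meson order_trans zero_le_power2)
  next
    case False
    then have "(1 - 2 * ?c) * ?d\<^sup>2 \<le> (1 - 2 * ?c) * (?r\<^sup>2 * (1 + ?c)\<^sup>2)"
      by (intro mult_left_mono d2) auto
    also have "\<dots> = ?r\<^sup>2 - ?r\<^sup>2 * (3 * ?c\<^sup>2 + 2 * (?c * ?c\<^sup>2))"
      by (simp add: power2_eq_square algebra_simps)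
    also have "\<dots> \<le> ?r\<^sup>2"
      using c by (simp add: mult_nonneg_nonneg)
    finally show ?thesis .
  qed
  moreover have "?r\<^sup>2 \<le> ?d\<^sup>2" using r rd by (intro power_mono) auto
  moreover have "0 < ?d\<^sup>2" using r rd by auto
  ultimately have "1 - 2 * ?c \<le> ?r\<^sup>2 / ?d\<^sup>2" "?r\<^sup>2 / ?d\<^sup>2 \<le> 1"
    by (simp_all add: pos_le_divide_eq)
  with c show ?thesis by linarith
qed

section \<open>Geodesic distances under bi-Lipschitz maps\<close>

text \<open>The geodesic distance is continuous in the Euclidean topology because it is at most the
Euclidean distance divided by \<open>C\<^sub>2\<close>.\<close>

lemma gdist_tendsto:
  assumes "\<And>n. p n \<in> M" "\<And>n. q n \<in> M" "u \<in> M" "v \<in> M"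
    and p: "p \<longlonglongrightarrow> u" and q: "q \<longlonglongrightarrow> v"
  shows "(\<lambda>n. gdist M (p n) (q n)) \<longlonglongrightarrow> gdist M u v"
proof (rule Lim_transform2[OF tendsto_const], rule Lim_null_comparison)
  show "\<forall>\<^sub>F n in sequentially. norm (gdist M u v - gdist M (p n) (q n)) \<le> (dist (p n) u + dist (q n) v) / C\<^sub>2"
  proof (intro always_eventually allI)
    fix n
    have "gdist M u v \<le> gdist M u (p n) + (gdist M (p n) (q n) + gdist M (q n) v)"
      using M_gdist_triangle[of u "p n" v] M_gdist_triangle[of "p n" "q n" v] assms by auto
    moreover have "gdist M (p n) (q n) \<le> gdist M (p n) u + (gdist M u v + gdist M v (q n))"
      using M_gdist_triangle[of "p n" u "q n"] M_gdist_triangle[of u v "q n"] assms by auto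
    ultimately have "norm (gdist M u v - gdist M (p n) (q n)) \<le> gdist M (p n) u + gdist M (q n) v"
      by (simp add: M_gdist_commute[of u "p n"] M_gdist_commute[of v "q n"])
    also have "\<dots> \<le> dist (p n) u / C\<^sub>2 + dist (q n) v / C\<^sub>2"
      by (intro add_mono gdist_le_dist_C2 assms)
    finally show "norm (gdist M u v - gdist M (p n) (q n)) \<le> (dist (p n) u + dist (q n) v) / C\<^sub>2"
      by (simp add: add_divide_distrib)
  qed
  have "(\<lambda>n. (dist (p n) u + dist (q n) v) / C\<^sub>2) \<longlonglongrightarrow> (dist u u + dist v v) / C\<^sub>2"
    by (intro tendsto_intros p q) (use C2_pos in auto)
  then show "(\<lambda>n. (dist (p n) u + dist (q n) v) / C\<^sub>2) \<longlonglongrightarrow> 0" by simp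
qed

text \<open>A Lipschitz constant with respect to the geodesic distance is a factor for lengths. Along an almost
shortest curve \<open>\<theta>\<close>, the geodesic distance of consecutive nodes exceeds their chord by a factor of at
most \<open>1 + C\<^sub>1 \<rho>\<close> once all chords are below \<open>\<rho>\<close>, so the grid sums of \<open>f \<circ> \<theta>\<close> are bounded by those of \<open>\<theta>\<close>
up to an arbitrarily small error.\<close>

lemma geodesic_dist_image_le:
  fixes f :: "'a \<Rightarrow> 'b::metric_space"
  assumes f: "continuous_on M f" and "0 \<le> K" "0 < \<epsilon>" "\<epsilon> \<le> \<epsilon>\<^sub>0"
    and lip: "\<And>u v. u \<in> M \<Longrightarrow> v \<in> M \<Longrightarrow> gdist M u v < \<epsilon> \<Longrightarrow> dist (f u) (f v) \<le> K * gdist M u v"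
    and uv: "u \<in> M" "v \<in> M"
  shows "geodesic_dist (f ` M) (f u) (f v) \<le> ereal (K * gdist M u v)"
proof (rule ereal_le_epsilon2)
  fix e :: real assume "0 < e"
  define A where "A = gdist M u v + e / (K + 1)"
  have A: "gdist M u v < A" "0 < A" "K * A \<le> K * gdist M u v + e"
    using \<open>0 < e\<close> \<open>0 \<le> K\<close> M_gdist_nonneg[OF uv]
    by (auto simp: A_def add_nonneg_pos ring_distribs pos_divide_le_eq)
  have "geodesic_dist M u v < ereal A"
    using A geodesic_dist_eq_gdist[OF rectifiably_connected_M uv] by simp
  then obtain \<theta> where \<theta>: "path \<theta>" "path_image \<theta> \<subseteq> M" "pathstart \<theta> = u" "pathfinish \<theta> = v"
    and len: "curve_length \<theta> < ereal A"
    unfolding geodesic_dist_def by (auto simp: Inf_less_iff)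
  have path: "path (f \<circ> \<theta>)"
    using \<theta> f by (intro path_continuous_image continuous_on_subset[OF f])
  have "curve_length (f \<circ> \<theta>) \<le> ereal (K * A)"
  proof (rule curve_length_le_of_grid[OF path])
    fix \<delta> :: real and m\<^sub>0 :: nat
    assume "0 < \<delta>"
    \<comment> \<open>The first bound keeps consecutive nodes within geodesic distance \<open>\<epsilon>\<close>, the second one keeps the
      excess \<open>K C\<^sub>1 \<rho> A\<close> below \<open>\<delta>\<close>.\<close>
    define \<rho> where "\<rho> = min (C\<^sub>2 * \<epsilon>) (\<delta> / (K * C\<^sub>1 * A + 1))"
    have KC: "0 \<le> K * C\<^sub>1 * A" using \<open>0 \<le> K\<close> C1_pos A by simp
    have \<rho>: "0 < \<rho>" "\<rho> \<le> C\<^sub>2 * \<epsilon>"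
      using KC C2_pos \<open>0 < \<epsilon>\<close> \<open>0 < \<delta>\<close> by (auto simp: \<rho>_def add_nonneg_pos)
    have "(K * C\<^sub>1 * A) * \<rho> \<le> (K * C\<^sub>1 * A + 1) * (\<delta> / (K * C\<^sub>1 * A + 1))"
      using KC \<rho>(1) by (intro mult_mono) (auto simp: \<rho>_def)
    also have "\<dots> = \<delta>" using KC by simp
    finally have \<rho>A: "K * (1 + C\<^sub>1 * \<rho>) * A \<le> K * A + \<delta>" by (simp add: algebra_simps)
    obtain m\<^sub>1 where m1: "\<And>m j. m \<ge> m\<^sub>1 \<Longrightarrow> j < m \<Longrightarrow> dist (\<theta> (real j / real m)) (\<theta> (real (Suc j) / real m)) < \<rho>"
      using path_grid_fine[OF \<theta>(1) \<rho>(1)] by blast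
    define m where "m = Suc (max m\<^sub>0 m\<^sub>1)"
    have "grid_length (f \<circ> \<theta>) m \<le> (\<Sum>j<m. K * (1 + C\<^sub>1 * \<rho>) * dist (\<theta> (real j / real m)) (\<theta> (real (Suc j) / real m)))"
      unfolding grid_length_def
    proof (rule sum_mono)
      fix j assume "j \<in> {..<m}"
      then have j: "j < m" by simp
      define p q where "p = \<theta> (real j / real m)" and "q = \<theta> (real (Suc j) / real m)"
      have pq: "p \<in> M" "q \<in> M"
        using \<theta>(2) j unfolding p_def q_def path_image_def by auto
      have near: "dist p q < \<rho>" using m1[of m j] j by (simp add: m_def p_def q_def)
      have g: "gdist M p q < \<epsilon>"
        using near \<rho>(2) by (intro gdist_less_of_dist_less[OF pq]) simp
      have "dist (f p) (f q) \<le> K * gdist M p q" by (rule lip[OF pq g])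
      also have "\<dots> \<le> K * (dist p q + C\<^sub>1 * (dist p q)\<^sup>2)"
        using gdist_upper[OF pq] g \<open>\<epsilon> \<le> \<epsilon>\<^sub>0\<close> \<open>0 \<le> K\<close> by (intro mult_left_mono) (auto simp: dist_norm)
      also have "\<dots> = K * ((1 + C\<^sub>1 * dist p q) * dist p q)"
        by (simp add: power2_eq_square algebra_simps)
      also have "\<dots> \<le> K * ((1 + C\<^sub>1 * \<rho>) * dist p q)"
        using near C1_pos \<open>0 \<le> K\<close> by (intro mult_left_mono mult_right_mono add_left_mono) auto
      finally show "dist ((f \<circ> \<theta>) (real j / real m)) ((f \<circ> \<theta>) (real (Suc j) / real m))
          \<le> K * (1 + C\<^sub>1 * \<rho>) * dist (\<theta> (real j / real m)) (\<theta> (real (Suc j) / real m))"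
        by (simp add: p_def q_def mult.assoc)
    qed
    also have "\<dots> = K * (1 + C\<^sub>1 * \<rho>) * grid_length \<theta> m"
      unfolding grid_length_def by (rule sum_distrib_left[symmetric])
    also have "\<dots> \<le> K * (1 + C\<^sub>1 * \<rho>) * A"
    proof (rule mult_left_mono)
      have "ereal (grid_length \<theta> m) < ereal A"
        by (rule order.strict_trans1[OF grid_length_le_curve_length len]) (simp add: m_def)
      then show "grid_length \<theta> m \<le> A" by simp
      show "0 \<le> K * (1 + C\<^sub>1 * \<rho>)" using \<open>0 \<le> K\<close> C1_pos \<rho> by simp
    qed
    finally have "grid_length (f \<circ> \<theta>) m \<le> K * A + \<delta>" using \<rho>A by linarith
    then show "\<exists>m\<ge>m\<^sub>0. grid_length (f \<circ> \<theta>) m \<le> K * A + \<delta>"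
      by (intro exI[of _ m]) (auto simp: m_def)
  qed
  moreover have "geodesic_dist (f ` M) (f u) (f v) \<le> curve_length (f \<circ> \<theta>)"
    using path \<theta> by (intro geodesic_dist_le_curve_length) (auto simp: path_image_compose pathstart_compose pathfinish_compose)
  moreover have "ereal (K * A) \<le> ereal (K * gdist M u v) + ereal e" using A by simp
  ultimately show "geodesic_dist (f ` M) (f u) (f v) \<le> ereal (K * gdist M u v) + ereal e"
    by (meson order_trans)
qed

text \<open>Since \<open>f\<close> is injective with a globally Lipschitz inverse, the nodes of a fine grid on a curve in the
image come from points of \<open>M\<close> whose consecutive geodesic distances are below \<open>\<epsilon>\<close>. The local expansion
bound applies to each step, and the triangle inequality in \<open>M\<close> collects the steps.\<close>

lemma geodesic_dist_image_ge:
  fixes f :: "'a \<Rightarrow> 'b::metric_space"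
  assumes "0 \<le> K" "0 < \<epsilon>"
    and expand: "\<And>u v. u \<in> M \<Longrightarrow> v \<in> M \<Longrightarrow> gdist M u v < \<epsilon> \<Longrightarrow> K * gdist M u v \<le> dist (f u) (f v)"
    and far: "\<And>u v. u \<in> M \<Longrightarrow> v \<in> M \<Longrightarrow> C\<^sub>2 * gdist M u v \<le> dist (f u) (f v)"
    and uv: "u \<in> M" "v \<in> M"
  shows "ereal (K * gdist M u v) \<le> geodesic_dist (f ` M) (f u) (f v)"
  unfolding geodesic_dist_def
proof (rule Inf_greatest, clarify)
  fix \<eta> assume \<eta>: "path \<eta>" "path_image \<eta> \<subseteq> f ` M" "pathstart \<eta> = f u" "pathfinish \<eta> = f v"
  have inj: "a = b" if "a \<in> M" "b \<in> M" "f a = f b" for a b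
  proof (rule ccontr)
    assume "a \<noteq> b"
    then have "0 < C\<^sub>2 * gdist M a b" using M_gdist_pos that C2_pos by simp
    with far[of a b] that show False by simp
  qed
  have "0 < C\<^sub>2 * \<epsilon>" using C2_pos \<open>0 < \<epsilon>\<close> by simp
  then obtain m\<^sub>1 where m1: "\<And>m j. m \<ge> m\<^sub>1 \<Longrightarrow> j < m \<Longrightarrow> dist (\<eta> (real j / real m)) (\<eta> (real (Suc j) / real m)) < C\<^sub>2 * \<epsilon>"
    using path_grid_fine[OF \<eta>(1)] by blast
  define m where "m = Suc m\<^sub>1"
  define p where "p = (\<lambda>j. inv_into M f (\<eta> (real j / real m)))"
  have p: "p j \<in> M" "f (p j) = \<eta> (real j / real m)" if "j \<le> m" for j
  proof -
    have "\<eta> (real j / real m) \<in> f ` M"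
      using \<eta>(2) that unfolding path_image_def by (auto simp: m_def)
    then show "p j \<in> M" "f (p j) = \<eta> (real j / real m)"
      unfolding p_def by (auto intro: inv_into_into f_inv_into_f)
  qed
  have "p 0 = u" "p m = v"
    using p[of 0] p[of m] uv \<eta>(3,4) by (auto intro!: inj simp: pathstart_def pathfinish_def m_def)
  then have "K * gdist M u v \<le> K * (\<Sum>j<m. gdist M (p j) (p (Suc j)))"
    using gdist_le_sum_consecutive[OF rectifiably_connected_M, of m p] p \<open>0 \<le> K\<close>
    by (intro mult_left_mono) auto
  also have "\<dots> = (\<Sum>j<m. K * gdist M (p j) (p (Suc j)))" by (rule sum_distrib_left)
  also have "\<dots> \<le> grid_length \<eta> m"
    unfolding grid_length_def
  proof (rule sum_mono)
    fix j assume "j \<in> {..<m}"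
    then have j: "j < m" by simp
    note pj = p[of j] p[of "Suc j"]
    have "C\<^sub>2 * gdist M (p j) (p (Suc j)) < C\<^sub>2 * \<epsilon>"
      using far[of "p j" "p (Suc j)"] pj m1[of m j] j by (simp add: m_def)
    then have "gdist M (p j) (p (Suc j)) < \<epsilon>" using C2_pos by simp
    then show "K * gdist M (p j) (p (Suc j)) \<le> dist (\<eta> (real j / real m)) (\<eta> (real (Suc j) / real m))"
      using expand[of "p j" "p (Suc j)"] pj j by simp
  qed
  finally have "ereal (K * gdist M u v) \<le> ereal (grid_length \<eta> m)" by simp
  also have "\<dots> \<le> curve_length \<eta>" by (rule grid_length_le_curve_length) (simp add: m_def)
  finally show "ereal (K * gdist M u v) \<le> curve_length \<eta>" .
qed

section \<open>Near isometry of minimizers\<close>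

context
  fixes y :: "nat \<Rightarrow> 'a" and \<epsilon> :: real
  assumes inj: "inj y" and yM: "range y \<subseteq> M" and dense: "M \<subseteq> closure (range y)"
    and eps: "0 < \<epsilon>" "\<epsilon> < \<epsilon>\<^sub>0"
begin

lemma y_in: "y i \<in> M" using yM by auto

text \<open>The data points compete in the minimization problem, so the distortion of a minimizer is at most
\<open>2 c\<close> with \<open>c = C\<^sub>1 \<epsilon>\<close>. Passing to square roots uses \<open>1 + 2 c \<le> (1 + 2 c)\<^sup>2\<close> and
\<open>(1 - 2 c)\<^sup>2 \<le> 1 - 2 c\<close> if \<open>2 c \<le> 1\<close>; for larger \<open>c\<close> the lower bound is trivial.\<close>

lemma minimizer_near_isometry:
  fixes z :: "nat \<Rightarrow> 'a"
  assumes min: "is_arg_min (distortion (\<lambda>i j. gdist M (y i) (y j)) \<epsilon> k)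
      (\<lambda>z. z \<in> feasible (\<lambda>i j. gdist M (y i) (y j)) C\<^sub>2 k) z"
    and ij: "i < k" "j < k" "gdist M (y i) (y j) < \<epsilon>"
  shows "gdist M (y i) (y j) * (1 - 2 * C\<^sub>1 * \<epsilon>) \<le> norm (z i - z j) \<and>
    norm (z i - z j) \<le> gdist M (y i) (y j) * (1 + 2 * C\<^sub>1 * \<epsilon>)"
proof (cases "i = j")
  case True
  then show ?thesis using y_in by (simp add: M_gdist_self)
next
  case False
  let ?D = "\<lambda>i j. gdist M (y i) (y j)"
  define c where "c = C\<^sub>1 * \<epsilon>"
  have c: "0 \<le> c" using C1_pos eps by (simp add: c_def)
  have d: "0 < ?D i j" using M_gdist_pos[OF y_in y_in] inj False by (auto dest: injD)
  have "y \<in> feasible ?D C\<^sub>2 k"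
    using C2_gdist_le_dist[OF y_in y_in] by (auto simp: feasible_def dist_norm)
  then have "distortion ?D \<epsilon> k z \<le> distortion ?D \<epsilon> k y"
    using min unfolding is_arg_min_def by (meson not_less)
  also have "\<dots> \<le> 2 * c"
    unfolding c_def
    by (intro distortion_le dist_over_gdist_near_1 y_in)
      (use eps C1_pos inj in \<open>auto dest: injD\<close>)
  finally have "\<bar>(norm (z i - z j))\<^sup>2 / (?D i j)\<^sup>2 - 1\<bar> \<le> 2 * c"
    using le_distortion[of i k j ?D \<epsilon> z] ij False by simp
  then have "1 - 2 * c \<le> (norm (z i - z j))\<^sup>2 / (?D i j)\<^sup>2" "(norm (z i - z j))\<^sup>2 / (?D i j)\<^sup>2 \<le> 1 + 2 * c"
    by linarith+
  then have lo: "(?D i j)\<^sup>2 * (1 - 2 * c) \<le> (norm (z i - z j))\<^sup>2"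
    and up: "(norm (z i - z j))\<^sup>2 \<le> (?D i j)\<^sup>2 * (1 + 2 * c)"
    using d by (simp_all add: field_simps)
  have "norm (z i - z j) \<le> ?D i j * (1 + 2 * c)"
  proof (rule power2_le_imp_le)
    have "(1 + 2 * c) * 1 \<le> (1 + 2 * c) * (1 + 2 * c)" using c by (intro mult_left_mono) auto
    then have "(?D i j)\<^sup>2 * (1 + 2 * c) \<le> (?D i j)\<^sup>2 * (1 + 2 * c)\<^sup>2"
      by (intro mult_left_mono) (auto simp: power2_eq_square)
    with up show "(norm (z i - z j))\<^sup>2 \<le> (?D i j * (1 + 2 * c))\<^sup>2"
      by (simp add: power_mult_distrib)
    show "0 \<le> ?D i j * (1 + 2 * c)" using d c by simp
  qed
  moreover have "?D i j * (1 - 2 * c) \<le> norm (z i - z j)"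
  proof (cases "1 - 2 * c \<le> 0")
    case True
    then have "?D i j * (1 - 2 * c) \<le> 0" using d by (simp add: mult_nonneg_nonpos)
    then show ?thesis by (meson order_trans norm_ge_zero)
  next
    case False
    then have "(1 - 2 * c) * (1 - 2 * c) \<le> (1 - 2 * c) * 1" using c by (intro mult_left_mono) auto
    then have "(?D i j)\<^sup>2 * (1 - 2 * c)\<^sup>2 \<le> (?D i j)\<^sup>2 * (1 - 2 * c)"
      by (intro mult_left_mono) (auto simp: power2_eq_square)
    with lo have "(?D i j * (1 - 2 * c))\<^sup>2 \<le> (norm (z i - z j))\<^sup>2"
      by (simp add: power_mult_distrib)
    then show ?thesis by (rule power2_le_imp_le) simp
  qed
  ultimately show ?thesis by (simp add: c_def mult.assoc)
qed

section \<open>Limits of minimizers\<close>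

lemma minimizers_bounded:
  fixes xs :: "nat \<Rightarrow> nat \<Rightarrow> 'a"
  assumes min: "\<And>k. is_arg_min (distortion (\<lambda>i j. gdist M (y i) (y j)) \<epsilon> k)
      (\<lambda>z. z \<in> feasible (\<lambda>i j. gdist M (y i) (y j)) C\<^sub>2 k) (xs k)"
  shows "\<exists>B. \<forall>\<^sub>F k in sequentially. norm (xs k i - xs k 0) \<le> B"
proof (rule connected_dense_chain_induct[where P = "\<lambda>i. \<exists>B. \<forall>\<^sub>F k in sequentially. norm (xs k i - xs k 0) \<le> B"
      and \<delta> = "C\<^sub>2 * \<epsilon>" and y = y and M = M and i\<^sub>0 = 0])
  show "connected M" by (rule rectifiably_connected_imp_connected[OF rectifiably_connected_M])
  show "0 < C\<^sub>2 * \<epsilon>" using C2_pos eps by simp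
  show "\<exists>B. \<forall>\<^sub>F k in sequentially. norm (xs k 0 - xs k 0) \<le> B" by (intro exI[of _ 0]) simp
  fix i j
  assume "\<exists>B. \<forall>\<^sub>F k in sequentially. norm (xs k i - xs k 0) \<le> B" and ij: "dist (y i) (y j) < C\<^sub>2 * \<epsilon>"
  then obtain B where B: "\<forall>\<^sub>F k in sequentially. norm (xs k i - xs k 0) \<le> B" by blast
  have d: "gdist M (y i) (y j) < \<epsilon>"
    by (rule gdist_less_of_dist_less[OF y_in y_in ij])
  have "\<forall>\<^sub>F k in sequentially. norm (xs k j - xs k 0) \<le> gdist M (y i) (y j) * (1 + 2 * C\<^sub>1 * \<epsilon>) + B"
    using B eventually_gt_at_top[of "max i j"]
  proof eventually_elim
    case (elim k)
    have "norm (xs k j - xs k 0) \<le> norm (xs k j - xs k i) + norm (xs k i - xs k 0)"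
      using norm_triangle_ineq[of "xs k j - xs k i" "xs k i - xs k 0"] by simp
    moreover have "norm (xs k j - xs k i) \<le> gdist M (y i) (y j) * (1 + 2 * C\<^sub>1 * \<epsilon>)"
      using minimizer_near_isometry[OF min, of i k j] elim d by (auto simp: norm_minus_commute)
    ultimately show ?case using elim by linarith
  qed
  then show "\<exists>B. \<forall>\<^sub>F k in sequentially. norm (xs k j - xs k 0) \<le> B" by blast
qed (use yM dense in auto)

context
  fixes x :: "nat \<Rightarrow> 'a"
  assumes lower: "\<And>i j. gdist M (y i) (y j) < \<epsilon> \<Longrightarrow> gdist M (y i) (y j) * (1 - 2 * C\<^sub>1 * \<epsilon>) \<le> norm (x i - x j)"
    and upper: "\<And>i j. gdist M (y i) (y j) < \<epsilon> \<Longrightarrow> norm (x i - x j) \<le> gdist M (y i) (y j) * (1 + 2 * C\<^sub>1 * \<epsilon>)"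
    and expand: "\<And>i j. C\<^sub>2 * gdist M (y i) (y j) \<le> norm (x i - x j)"
begin

text \<open>On the data points the limit map is uniformly continuous, being Lipschitz at small scales.\<close>

lemma continuous_extension_exists: "\<exists>f. continuous_on M f \<and> (\<forall>i. f (y i) = x i)"
proof -
  define g where "g = (\<lambda>u. x (inv y u))"
  have g: "g (y i) = x i" for i using inj by (simp add: g_def)
  define K where "K = (1 + 2 * C\<^sub>1 * \<epsilon>) / C\<^sub>2"
  have K: "0 < K" using C1_pos C2_pos eps by (simp add: K_def add_pos_pos)
  have "uniformly_continuous_on (range y) g"
    unfolding uniformly_continuous_on_def
  proof (intro allI impI)
    fix e :: real assume "0 < e"
    have "dist (g (y j)) (g (y i)) < e" if "dist (y j) (y i) < min (C\<^sub>2 * \<epsilon>) (e / K)" for i j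
    proof -
      have "gdist M (y j) (y i) \<le> dist (y j) (y i) / C\<^sub>2" by (rule gdist_le_dist_C2[OF y_in y_in])
      moreover have "gdist M (y j) (y i) < \<epsilon>"
        using that by (intro gdist_less_of_dist_less[OF y_in y_in]) simp
      ultimately have "norm (x j - x i) \<le> dist (y j) (y i) / C\<^sub>2 * (1 + 2 * C\<^sub>1 * \<epsilon>)"
        using upper[of j i] C1_pos eps by (meson add_nonneg_nonneg less_imp_le mult_nonneg_nonneg
            mult_right_mono order_trans zero_le_numeral zero_le_one)
      also have "\<dots> = dist (y j) (y i) * K" by (simp add: K_def)
      also have "\<dots> < e" using that K by (simp add: field_simps)
      finally show ?thesis by (simp add: g dist_norm)
    qed
    moreover have "0 < min (C\<^sub>2 * \<epsilon>) (e / K)" using \<open>0 < e\<close> K C2_pos eps by simp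
    ultimately show "\<exists>d>0. \<forall>u\<in>range y. \<forall>v\<in>range y. dist v u < d \<longrightarrow> dist (g v) (g u) < e"
      by (intro exI[of _ "min (C\<^sub>2 * \<epsilon>) (e / K)"]) blast
  qed
  then obtain f where f: "uniformly_continuous_on (closure (range y)) f" "\<And>u. u \<in> range y \<Longrightarrow> g u = f u"
    by (rule uniformly_continuous_on_extension_on_closure) blast
  have "continuous_on M f"
    using continuous_on_subset[OF uniformly_continuous_imp_continuous[OF f(1)] dense] .
  moreover have "f (y i) = x i" for i using f(2)[of "y i"] g by simp
  ultimately show ?thesis by blast
qed

text \<open>Both distances are continuous, so the bounds extend from the dense set of data points.\<close>

lemma extension_bounds:
  assumes f: "continuous_on M f" "\<And>i. f (y i) = x i" and uv: "u \<in> M" "v \<in> M"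
  shows "C\<^sub>2 * gdist M u v \<le> norm (f u - f v)"
    and "gdist M u v < \<epsilon> \<Longrightarrow> gdist M u v * (1 - 2 * C\<^sub>1 * \<epsilon>) \<le> norm (f u - f v)"
    and "gdist M u v < \<epsilon> \<Longrightarrow> norm (f u - f v) \<le> gdist M u v * (1 + 2 * C\<^sub>1 * \<epsilon>)"
proof -
  have approx: "\<exists>s. (\<lambda>n. y (s n)) \<longlonglongrightarrow> w" if w: "w \<in> M" for w
  proof -
    have "w \<in> closure (range y)" using dense w by auto
    then obtain p where p: "\<And>n. p n \<in> range y" "p \<longlonglongrightarrow> w"
      unfolding closure_sequential by blast
    then have "\<forall>n. \<exists>i. p n = y i" by auto
    then obtain s where "\<forall>n. p n = y (s n)" by (rule choice[THEN exE]) blast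
    then have "p = (\<lambda>n. y (s n))" by auto
    with p(2) show ?thesis by auto
  qed
  obtain s t where st: "(\<lambda>n. y (s n)) \<longlonglongrightarrow> u" "(\<lambda>n. y (t n)) \<longlonglongrightarrow> v"
    using approx uv by blast
  have d: "(\<lambda>n. gdist M (y (s n)) (y (t n))) \<longlonglongrightarrow> gdist M u v"
    by (rule gdist_tendsto[OF y_in y_in uv st])
  have "(\<lambda>n. f (y (s n))) \<longlonglongrightarrow> f u" "(\<lambda>n. f (y (t n))) \<longlonglongrightarrow> f v"
    using st y_in uv by (auto intro!: continuous_on_tendsto_compose[OF f(1)])
  then have nrm: "(\<lambda>n. norm (x (s n) - x (t n))) \<longlonglongrightarrow> norm (f u - f v)"
    unfolding f(2) by (intro tendsto_intros)
  show "C\<^sub>2 * gdist M u v \<le> norm (f u - f v)"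
    by (rule tendsto_le[OF _ nrm tendsto_mult[OF tendsto_const d]]) (auto simp: expand)
  assume "gdist M u v < \<epsilon>"
  then have ev: "\<forall>\<^sub>F n in sequentially. gdist M (y (s n)) (y (t n)) < \<epsilon>"
    using d by (intro order_tendstoD(2))
  show "gdist M u v * (1 - 2 * C\<^sub>1 * \<epsilon>) \<le> norm (f u - f v)"
    by (rule tendsto_le[OF _ nrm tendsto_mult[OF d tendsto_const]])
      (use ev in \<open>auto elim!: eventually_mono intro: lower\<close>)
  show "norm (f u - f v) \<le> gdist M u v * (1 + 2 * C\<^sub>1 * \<epsilon>)"
    by (rule tendsto_le[OF _ tendsto_mult[OF d tendsto_const] nrm])
      (use ev in \<open>auto elim!: eventually_mono intro: upper\<close>)
qed

lemma extension_geodesic_bounds: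
  assumes f: "continuous_on M f" "\<And>i. f (y i) = x i"
  shows "ereal (gdist M (y i) (y j) * (1 - 2 * C\<^sub>1 * \<epsilon>)) \<le> geodesic_dist (f ` M) (x i) (x j)"
    and "geodesic_dist (f ` M) (x i) (x j) \<le> ereal (gdist M (y i) (y j) * (1 + 2 * C\<^sub>1 * \<epsilon>))"
proof -
  note b = extension_bounds[OF f]
  have "geodesic_dist (f ` M) (f (y i)) (f (y j)) \<le> ereal ((1 + 2 * C\<^sub>1 * \<epsilon>) * gdist M (y i) (y j))"
  proof (rule geodesic_dist_image_le[OF f(1)])
    show "0 \<le> 1 + 2 * C\<^sub>1 * \<epsilon>" using C1_pos eps by simp
    show "dist (f u) (f v) \<le> (1 + 2 * C\<^sub>1 * \<epsilon>) * gdist M u v"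
      if "u \<in> M" "v \<in> M" "gdist M u v < \<epsilon>" for u v
      unfolding dist_norm mult.commute[of "1 + 2 * C\<^sub>1 * \<epsilon>"] by (rule b(3)[OF that])
  qed (use eps y_in in auto)
  then show "geodesic_dist (f ` M) (x i) (x j) \<le> ereal (gdist M (y i) (y j) * (1 + 2 * C\<^sub>1 * \<epsilon>))"
    unfolding f(2) mult.commute[of "1 + 2 * C\<^sub>1 * \<epsilon>"] .
  show "ereal (gdist M (y i) (y j) * (1 - 2 * C\<^sub>1 * \<epsilon>)) \<le> geodesic_dist (f ` M) (x i) (x j)"
  proof (cases "0 \<le> 1 - 2 * C\<^sub>1 * \<epsilon>")
    case True
    have "ereal ((1 - 2 * C\<^sub>1 * \<epsilon>) * gdist M (y i) (y j)) \<le> geodesic_dist (f ` M) (f (y i)) (f (y j))"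
    proof (rule geodesic_dist_image_ge[OF True eps(1)])
      show "(1 - 2 * C\<^sub>1 * \<epsilon>) * gdist M u v \<le> dist (f u) (f v)"
        if "u \<in> M" "v \<in> M" "gdist M u v < \<epsilon>" for u v
        unfolding dist_norm mult.commute[of "1 - 2 * C\<^sub>1 * \<epsilon>"] by (rule b(2)[OF that])
      show "C\<^sub>2 * gdist M u v \<le> dist (f u) (f v)" if "u \<in> M" "v \<in> M" for u v
        using b(1)[OF that] by (simp only: dist_norm)
    qed (rule y_in)+
    then show ?thesis unfolding f(2) mult.commute[of "1 - 2 * C\<^sub>1 * \<epsilon>"] .
  next
    case False
    then have "gdist M (y i) (y j) * (1 - 2 * C\<^sub>1 * \<epsilon>) \<le> 0"
      using M_gdist_nonneg[OF y_in y_in] by (intro mult_nonneg_nonpos) auto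
    then have "ereal (gdist M (y i) (y j) * (1 - 2 * C\<^sub>1 * \<epsilon>)) \<le> 0" by simp
    from this geodesic_dist_nonneg[of "f ` M" "x i" "x j"] show ?thesis by (rule order_trans)
  qed
qed

end

lemma minimizers_embedding_limit:
  fixes xs :: "nat \<Rightarrow> nat \<Rightarrow> 'a"
  assumes min: "\<And>k. is_arg_min (distortion (\<lambda>i j. gdist M (y i) (y j)) \<epsilon> k)
      (\<lambda>z. z \<in> feasible (\<lambda>i j. gdist M (y i) (y j)) C\<^sub>2 k) (xs k)"
  shows "embedding_limit M y C\<^sub>1 \<epsilon> xs"
proof -
  have bounded: "\<exists>B. \<forall>\<^sub>F k in sequentially. norm (xs k i - xs k 0) \<le> B" for i
    by (rule minimizers_bounded[where xs = xs and i = i]) (rule min)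
  obtain r \<tau> x where r: "strict_mono (r :: nat \<Rightarrow> nat)"
    and \<tau>: "\<not> filterlim (\<lambda>k. xs k 0) at_infinity sequentially \<longrightarrow> \<tau> = (\<lambda>k. 0)"
    and lim': "\<forall>i. (\<lambda>k. xs (r k) i + \<tau> k) \<longlonglongrightarrow> x i"
    using convergent_subsequence_up_to_translation[of xs, OF bounded]
    by (elim exE conjE, intro that)
  have lim: "(\<lambda>k. xs (r k) i + \<tau> k) \<longlonglongrightarrow> x i" for i using lim' by simp
  have nrm: "(\<lambda>k. norm (xs (r k) i - xs (r k) j)) \<longlonglongrightarrow> norm (x i - x j)" for i j
    using tendsto_norm[OF tendsto_diff[OF lim[of i] lim[of j]]] by simp
  have ev: "\<forall>\<^sub>F k in sequentially. i < r k \<and> j < r k" for i j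
    using eventually_subseq[OF r eventually_gt_at_top[of "max i j"]] by simp
  have lower: "gdist M (y i) (y j) * (1 - 2 * C\<^sub>1 * \<epsilon>) \<le> norm (x i - x j)"
    if "gdist M (y i) (y j) < \<epsilon>" for i j
    by (rule tendsto_lowerbound[OF nrm], rule eventually_mono[OF ev[of i j]])
      (use minimizer_near_isometry[OF min] that in auto)
  have upper: "norm (x i - x j) \<le> gdist M (y i) (y j) * (1 + 2 * C\<^sub>1 * \<epsilon>)"
    if "gdist M (y i) (y j) < \<epsilon>" for i j
    by (rule tendsto_upperbound[OF nrm], rule eventually_mono[OF ev[of i j]])
      (use minimizer_near_isometry[OF min] that in auto)
  have expand: "C\<^sub>2 * gdist M (y i) (y j) \<le> norm (x i - x j)" for i j
    by (rule tendsto_lowerbound[OF nrm], rule eventually_mono[OF ev[of i j]])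
      (use min in \<open>auto simp: is_arg_min_def feasible_def\<close>)
  have "\<exists>f. continuous_on M f \<and> (\<forall>i. f (y i) = x i)"
    by (rule continuous_extension_exists[where x = x]) (fact lower upper expand)+
  note ext = this
  have geo: "ereal (gdist M (y i) (y j) * (1 - 2 * C\<^sub>1 * \<epsilon>)) \<le> geodesic_dist (f ` M) (x i) (x j) \<and>
      geodesic_dist (f ` M) (x i) (x j) \<le> ereal (gdist M (y i) (y j) * (1 + 2 * C\<^sub>1 * \<epsilon>))"
    if "continuous_on M f \<and> (\<forall>i. f (y i) = x i)" for f i j
  proof
    have f: "continuous_on M f" "\<And>i. f (y i) = x i" using that by auto
    show "ereal (gdist M (y i) (y j) * (1 - 2 * C\<^sub>1 * \<epsilon>)) \<le> geodesic_dist (f ` M) (x i) (x j)"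
      by (rule extension_geodesic_bounds(1)[where x = x]) (fact lower upper expand f)+
    show "geodesic_dist (f ` M) (x i) (x j) \<le> ereal (gdist M (y i) (y j) * (1 + 2 * C\<^sub>1 * \<epsilon>))"
      by (rule extension_geodesic_bounds(2)[where x = x]) (fact lower upper expand f)+
  qed
  have near: "\<forall>i j. gdist M (y i) (y j) < \<epsilon> \<longrightarrow>
      gdist M (y i) (y j) * (1 - 2 * C\<^sub>1 * \<epsilon>) \<le> norm (x i - x j) \<and>
      norm (x i - x j) \<le> gdist M (y i) (y j) * (1 + 2 * C\<^sub>1 * \<epsilon>)"
    by (intro allI impI conjI lower upper)
  have geo': "\<forall>f. continuous_on M f \<and> (\<forall>i. f (y i) = x i) \<longrightarrow>
      (\<forall>i j. ereal (gdist M (y i) (y j) * (1 - 2 * C\<^sub>1 * \<epsilon>)) \<le> geodesic_dist (f ` M) (x i) (x j) \<and>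
        geodesic_dist (f ` M) (x i) (x j) \<le> ereal (gdist M (y i) (y j) * (1 + 2 * C\<^sub>1 * \<epsilon>)))"
    by (intro allI impI geo)
  show ?thesis
    unfolding embedding_limit_def Let_def
    by (rule exI[of _ r], rule exI[of _ \<tau>], rule exI[of _ x], intro conjI) (fact r \<tau> lim' near ext geo')+
qed

end
end

lemma embedding_assms_imp_embedding_concl:
  fixes M :: "'a::euclidean_space set"
  assumes "inj y" "range y \<subseteq> M" "M \<subseteq> closure (range y)" "embedding_assms M \<epsilon>\<^sub>0 C\<^sub>1 C\<^sub>2"
  shows "embedding_concl M y \<epsilon>\<^sub>0 C\<^sub>1 C\<^sub>2"
  unfolding embedding_concl_def Let_def
proof (intro allI impI, elim conjE)
  fix \<epsilon> and xs :: "nat \<Rightarrow> nat \<Rightarrow> 'a"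
  assume eps: "0 < \<epsilon>" "\<epsilon> < \<epsilon>\<^sub>0"
    and min: "\<forall>k. is_arg_min (distortion (\<lambda>i j. gdist M (y i) (y j)) \<epsilon> k)
      (\<lambda>z. z \<in> feasible (\<lambda>i j. gdist M (y i) (y j)) C\<^sub>2 k) (xs k)"
  show "embedding_limit M y C\<^sub>1 \<epsilon> xs"
    by (rule minimizers_embedding_limit[OF assms(4,1,2,3) eps]) (rule min[rule_format])
qed

section \<open>Nearest points and the reach\<close>

definition nearest :: "'a::metric_space set \<Rightarrow> 'a \<Rightarrow> 'a \<Rightarrow> bool" where
  "nearest M p q \<longleftrightarrow> q \<in> M \<and> (\<forall>q'\<in>M. dist p q \<le> dist p q')"

definition uniquely_projecting :: "'a::metric_space set \<Rightarrow> real \<Rightarrow> bool" where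
  "uniquely_projecting M e \<longleftrightarrow> 0 < e \<and> (\<forall>p \<in> (\<Union>q\<in>M. ball q e). \<exists>!q. nearest M p q)"

lemma reach_eq_Sup_uniquely_projecting: "reach M = Sup {ereal e | e. uniquely_projecting M e}"
  unfolding reach_def uniquely_projecting_def nearest_def ..

lemma uniquely_projecting_of_less_reach:
  assumes "0 < e" "ereal e < reach M"
  shows "uniquely_projecting M e"
proof -
  obtain e' where "ereal e < ereal e'" "uniquely_projecting M e'"
    using assms(2) unfolding reach_eq_Sup_uniquely_projecting less_Sup_iff
    by (auto simp del: ereal_less)
  then have "e \<le> e'" and uniq: "\<forall>p\<in>(\<Union>q\<in>M. ball q e'). \<exists>!q. nearest M p q"
    unfolding uniquely_projecting_def by simp_all
  then have "p \<in> (\<Union>q\<in>M. ball q e')" if "p \<in> (\<Union>q\<in>M. ball q e)" for p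
    using that subset_ball[OF \<open>e \<le> e'\<close>] by (meson UN_iff subsetD)
  then show ?thesis using assms(1) uniq unfolding uniquely_projecting_def by blast
qed

lemma nearest_exists:
  fixes M :: "'a::heine_borel set"
  assumes "compact M" "M \<noteq> {}"
  shows "\<exists>q. nearest M p q"
proof -
  obtain q where "q \<in> M" "\<And>b. b \<in> M \<Longrightarrow> dist p q \<le> dist p b"
    using distance_attains_inf[of M p] assms compact_imp_closed by metis
  then show ?thesis unfolding nearest_def by auto
qed

lemma nearest_ray_iff:
  fixes u :: "'a::real_normed_vector"
  assumes "norm u = 1" "0 \<le> t"
  shows "nearest M (a + t *\<^sub>R u) a \<longleftrightarrow> a \<in> M \<and> (\<forall>b\<in>M. t \<le> dist (a + t *\<^sub>R u) b)"
  using assms by (simp add: nearest_def dist_norm)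

lemma nearest_ray_mono:
  fixes u :: "'a::real_normed_vector"
  assumes u: "norm u = 1" and st: "0 \<le> s" "s \<le> t" and near: "nearest M (a + t *\<^sub>R u) a"
  shows "nearest M (a + s *\<^sub>R u) a"
proof -
  have "s \<le> dist (a + s *\<^sub>R u) b" if "b \<in> M" for b
  proof -
    have "t \<le> dist (a + t *\<^sub>R u) b" using nearest_ray_iff[OF u, of t M a] near st that by simp
    also have "\<dots> \<le> dist (a + t *\<^sub>R u) (a + s *\<^sub>R u) + dist (a + s *\<^sub>R u) b" by (rule dist_triangle)
    also have "dist (a + t *\<^sub>R u) (a + s *\<^sub>R u) = t - s"
      using u st by (simp add: dist_norm scaleR_diff_left[symmetric])
    finally show ?thesis by simp
  qed
  moreover have "a \<in> M" using near by (simp add: nearest_def)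
  ultimately show ?thesis using nearest_ray_iff[OF u st(1)] by blast
qed

context
  fixes M :: "'a::euclidean_space set" and e :: real
  assumes comp: "compact M" and proj: "uniquely_projecting M e"
begin

lemma nearest_unique: "a \<in> M \<Longrightarrow> dist a p < e \<Longrightarrow> nearest M p q \<Longrightarrow> nearest M p q' \<Longrightarrow> q = q'"
  using proj unfolding uniquely_projecting_def by fastforce

text \<open>The graph of the projection is closed and \<open>M\<close> is compact.\<close>

lemma continuous_projection_exists:
  "\<exists>P. continuous_on (\<Union>q\<in>M. ball q e) P \<and> (\<forall>p\<in>(\<Union>q\<in>M. ball q e). nearest M p (P p))"
proof -
  let ?N = "\<Union>q\<in>M. ball q e"
  define P where "P = (\<lambda>p. THE q. nearest M p q)"
  have uniq: "\<exists>!q. nearest M p q" if "p \<in> ?N" for p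
    using proj that unfolding uniquely_projecting_def by blast
  have near: "nearest M p (P p)" if "p \<in> ?N" for p
    unfolding P_def by (rule theI'[OF uniq[OF that]])
  have graph: "(\<lambda>p. (p, P p)) ` ?N = (?N \<times> M) \<inter> (\<Inter>b\<in>M. {z. dist (fst z) (snd z) \<le> dist (fst z) b})"
  proof (rule set_eqI, clarify)
    fix p q
    have "(p, q) \<in> (\<lambda>p. (p, P p)) ` ?N \<longleftrightarrow> p \<in> ?N \<and> q = P p" by blast
    also have "\<dots> \<longleftrightarrow> p \<in> ?N \<and> nearest M p q" using near uniq by blast
    also have "\<dots> \<longleftrightarrow> (p, q) \<in> (?N \<times> M) \<inter> (\<Inter>b\<in>M. {z. dist (fst z) (snd z) \<le> dist (fst z) b})"
      unfolding nearest_def by auto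
    finally show "(p, q) \<in> (\<lambda>p. (p, P p)) ` ?N
      \<longleftrightarrow> (p, q) \<in> (?N \<times> M) \<inter> (\<Inter>b\<in>M. {z. dist (fst z) (snd z) \<le> dist (fst z) b})" .
  qed
  have "closed (\<Inter>b\<in>M. {z :: 'a \<times> 'a. dist (fst z) (snd z) \<le> dist (fst z) b})"
    by (intro closed_INT ballI closed_Collect_le continuous_intros)
  then have "closedin (top_of_set (?N \<times> M)) ((\<lambda>p. (p, P p)) ` ?N)"
    unfolding graph by (intro closedin_closed_Int)
  moreover have "P \<in> ?N \<rightarrow> M" using near unfolding nearest_def by blast
  ultimately have "continuous_on ?N P"
    using continuous_closed_graph_eq[OF comp] by blast
  with near show ?thesis by blast
qed

text \<open>Let \<open>z\<close> be the point at distance \<open>\<tau>\<close> on the ray. The map that sends \<open>w\<close> to the point at distance \<open>\<rho>\<close> from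
\<open>z\<close> in the direction away from the projection of \<open>w\<close> has a fixed point \<open>w\<close> by Brouwer's theorem. Then
\<open>z\<close> lies between \<open>w\<close> and the projection of \<open>w\<close>, so that projection is also nearest to \<open>z\<close> and hence equals
\<open>a\<close>. Consequently \<open>w\<close> is the point at distance \<open>\<tau> + \<rho>\<close> on the ray.\<close>

lemma nearest_ray_step:
  assumes u: "norm u = 1" and \<rho>: "0 < \<rho>" "\<rho> < \<tau>" "\<tau> + \<rho> < e"
    and near: "nearest M (a + \<tau> *\<^sub>R u) a"
  shows "nearest M (a + (\<tau> + \<rho>) *\<^sub>R u) a"
proof -
  define z where "z = a + \<tau> *\<^sub>R u"
  have aM: "a \<in> M" using near by (simp add: nearest_def)
  have far: "\<tau> \<le> dist z b" if "b \<in> M" for b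
    using nearest_ray_iff[OF u, of \<tau> M a] near \<rho> that by (simp add: z_def)
  have daz: "dist a z = \<tau>" using u \<rho> by (simp add: z_def dist_norm)
  obtain P where P: "continuous_on (\<Union>q\<in>M. ball q e) P" "\<And>p. p \<in> (\<Union>q\<in>M. ball q e) \<Longrightarrow> nearest M p (P p)"
    using continuous_projection_exists by blast
  have sub: "cball z \<rho> \<subseteq> (\<Union>q\<in>M. ball q e)"
  proof
    fix w assume "w \<in> cball z \<rho>"
    then have "dist a w < e" using dist_triangle[of a w z] daz \<rho> by simp
    then show "w \<in> (\<Union>q\<in>M. ball q e)" using aM by auto
  qed
  have PM: "P w \<in> M" if "w \<in> cball z \<rho>" for w
    using P(2) sub that unfolding nearest_def by blast
  have away: "\<tau> \<le> norm (z - P w)" if "w \<in> cball z \<rho>" for w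
    using far[OF PM[OF that]] by (simp add: dist_norm)
  define G where "G = (\<lambda>w. z + (\<rho> / norm (z - P w)) *\<^sub>R (z - P w))"
  obtain w where w: "w \<in> cball z \<rho>" and fixed: "G w = w"
  proof (rule brouwer_ball[OF \<rho>(1)])
    have "norm (z - P w) \<noteq> 0" if "w \<in> cball z \<rho>" for w using away[OF that] \<rho> by linarith
    then show "continuous_on (cball z \<rho>) G"
      unfolding G_def by (intro continuous_intros continuous_on_subset[OF P(1) sub]) auto
    show "G \<in> cball z \<rho> \<rightarrow> cball z \<rho>" using \<rho> by (auto simp: G_def dist_norm)
  qed blast
  define c where "c = \<rho> / norm (z - P w)"
  have "0 < norm (z - P w)" using away[OF w] \<rho> by linarith
  then have c: "0 < c" using \<rho> by (simp add: c_def)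
  have wz: "w - z = c *\<^sub>R (z - P w)" using fixed by (simp add: G_def c_def algebra_simps)
  have nw: "nearest M w (P w)" using P(2) w sub by blast
  have "nearest M z (P w)"
    unfolding nearest_def
  proof (intro conjI ballI)
    show "P w \<in> M" by (rule PM[OF w])
    fix b assume b: "b \<in> M"
    have "w - P w = (c + 1) *\<^sub>R (z - P w)"
      using wz by (simp add: algebra_simps)
    then have "norm (w - P w) = (c + 1) * norm (z - P w)" using c by simp
    then have "dist w (P w) = c * norm (z - P w) + dist z (P w)"
      by (simp add: dist_norm ring_distribs)
    moreover have "dist w z = c * norm (z - P w)" using c by (simp add: dist_norm wz)
    moreover have "dist w (P w) \<le> dist w b" using nw b by (simp add: nearest_def)
    ultimately show "dist z (P w) \<le> dist z b" using dist_triangle[of w b z] by linarith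
  qed
  moreover have "nearest M z a" using near by (simp add: z_def)
  ultimately have "P w = a" using nearest_unique[OF aM, of z] daz \<rho> by simp
  moreover have "w = a + (\<tau> + \<rho>) *\<^sub>R u"
  proof -
    have "z - a = \<tau> *\<^sub>R u" by (simp add: z_def)
    then have "w - z = (\<rho> / \<tau>) *\<^sub>R (\<tau> *\<^sub>R u)"
      using wz \<open>P w = a\<close> u \<rho> by (simp add: c_def)
    also have "\<dots> = \<rho> *\<^sub>R u" using \<rho> by simp
    finally show ?thesis by (simp add: z_def algebra_simps)
  qed
  ultimately show ?thesis using nw by simp
qed

text \<open>The distances at which \<open>a\<close> is nearest form an interval that is closed in \<open>(0, e)\<close>, and by the
previous lemma its supremum cannot lie below \<open>e\<close>.\<close>

lemma nearest_ray_extends: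
  assumes u: "norm u = 1" and t0: "0 < t\<^sub>0" "nearest M (a + t\<^sub>0 *\<^sub>R u) a" and t: "0 < t" "t < e"
  shows "nearest M (a + t *\<^sub>R u) a"
proof -
  define T where "T = {s. 0 < s \<and> s < e \<and> nearest M (a + s *\<^sub>R u) a}"
  define \<tau> where "\<tau> = Sup T"
  have e: "0 < e" using t by simp
  have aM: "a \<in> M" using t0 by (simp add: nearest_def)
  have t1: "min t\<^sub>0 (e / 2) \<in> T"
    using t0 e nearest_ray_mono[OF u, of "min t\<^sub>0 (e / 2)" t\<^sub>0] by (auto simp: T_def)
  have bdd: "bdd_above T" by (rule bdd_aboveI[of _ e]) (auto simp: T_def)
  have T_le: "s \<le> \<tau>" if "s \<in> T" for s unfolding \<tau>_def using that bdd by (rule cSup_upper)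
  have \<tau>_pos: "0 < \<tau>" using T_le[OF t1] t0 e by auto
  have approx: "\<exists>s\<in>T. r < s" if "r < \<tau>" for r
    using that less_cSup_iff[OF _ bdd] t1 unfolding \<tau>_def by blast
  have "e \<le> \<tau>"
  proof (rule ccontr)
    assume "\<not> e \<le> \<tau>"
    have "\<tau> \<le> dist (a + \<tau> *\<^sub>R u) b" if b: "b \<in> M" for b
    proof (rule field_le_epsilon)
      fix d :: real assume "0 < d"
      then obtain s where s: "s \<in> T" "\<tau> - d / 2 < s" using approx[of "\<tau> - d / 2"] by auto
      have "s \<le> dist (a + s *\<^sub>R u) b"
        using s(1) b nearest_ray_iff[OF u, of s M a] by (auto simp: T_def)
      also have "\<dots> \<le> dist (a + s *\<^sub>R u) (a + \<tau> *\<^sub>R u) + dist (a + \<tau> *\<^sub>R u) b" by (rule dist_triangle)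
      also have "dist (a + s *\<^sub>R u) (a + \<tau> *\<^sub>R u) = \<tau> - s"
        using u T_le[OF s(1)] by (simp add: dist_norm scaleR_diff_left[symmetric])
      finally show "\<tau> \<le> dist (a + \<tau> *\<^sub>R u) b + d" using s(2) by linarith
    qed
    then have near: "nearest M (a + \<tau> *\<^sub>R u) a"
      using nearest_ray_iff[OF u, of \<tau> M a] \<tau>_pos aM by simp
    define \<rho> where "\<rho> = min \<tau> (e - \<tau>) / 2"
    have \<rho>: "0 < \<rho>" "\<rho> < \<tau>" "\<tau> + \<rho> < e"
      using \<tau>_pos \<open>\<not> e \<le> \<tau>\<close> by (auto simp: \<rho>_def min_def field_simps)
    have "\<tau> + \<rho> \<in> T"
      using nearest_ray_step[OF u \<rho> near] \<rho> \<tau>_pos by (simp add: T_def)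
    then show False using T_le \<rho> by fastforce
  qed
  then obtain s where "s \<in> T" "t < s" using approx[of t] t by auto
  then show ?thesis using nearest_ray_mono[OF u, of t s M a] t by (simp add: T_def)
qed

end

lemma inner_le_of_nearest:
  fixes u :: "'a::real_inner"
  assumes "norm u = 1" "0 \<le> t" "nearest M (a + t *\<^sub>R u) a" "b \<in> M"
  shows "2 * t * (u \<bullet> (b - a)) \<le> (dist a b)\<^sup>2"
proof -
  have "t \<le> dist (a + t *\<^sub>R u) b" using assms nearest_ray_iff[of u t M a] by blast
  then have "t\<^sup>2 \<le> (dist (a + t *\<^sub>R u) b)\<^sup>2" using assms by (intro power_mono) auto
  also have "dist (a + t *\<^sub>R u) b = norm (t *\<^sub>R u - (b - a))" by (simp add: dist_norm algebra_simps)
  also have "(norm (t *\<^sub>R u - (b - a)))\<^sup>2 = (norm (t *\<^sub>R u))\<^sup>2 - 2 * (t *\<^sub>R u \<bullet> (b - a)) + (norm (b - a))\<^sup>2"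
    by (simp only: power2_norm_eq_inner inner_diff_left inner_diff_right inner_commute) simp
  also have "\<dots> = t\<^sup>2 - 2 * t * (u \<bullet> (b - a)) + (norm (b - a))\<^sup>2"
    using assms(1) by (simp add: power_mult_distrib)
  finally show ?thesis by (simp add: dist_norm norm_minus_commute)
qed

text \<open>Geometrically: the ball of radius \<open>\<alpha>\<close> that touches \<open>M\<close> at \<open>a\<close> in the direction \<open>u\<close> contains no point of
\<open>M\<close> in its interior. It is the limit of the balls of radius \<open>t < \<alpha>\<close>.\<close>

lemma reach_inner_bound:
  fixes M :: "'a::euclidean_space set"
  assumes "compact M" "ereal \<alpha> \<le> reach M" "0 < \<alpha>"
    and "norm u = 1" "0 < t\<^sub>0" "nearest M (a + t\<^sub>0 *\<^sub>R u) a" "b \<in> M"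
  shows "2 * \<alpha> * (u \<bullet> (b - a)) \<le> (dist a b)\<^sup>2"
proof (rule ccontr)
  assume neg: "\<not> ?thesis"
  define I where "I = u \<bullet> (b - a)"
  have "0 < 2 * \<alpha> * I" using neg zero_le_power2[of "dist a b"] unfolding I_def by linarith
  then have I: "0 < I" using \<open>0 < \<alpha>\<close> by (simp add: zero_less_mult_iff)
  have "(dist a b)\<^sup>2 / (2 * I) < \<alpha>" using neg I by (simp add: I_def field_simps)
  then obtain t where t: "(dist a b)\<^sup>2 / (2 * I) < t" "t < \<alpha>" using dense by blast
  have "0 \<le> (dist a b)\<^sup>2 / (2 * I)" using I by simp
  with t have "0 < t" by linarith
  obtain e where e: "t < e" "e < \<alpha>" using dense[OF t(2)] by blast
  have "ereal e < reach M" using assms(2) e(2) by (meson ereal_less_eq(3) less_ereal.simps(1) order.strict_trans2)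
  then have "uniquely_projecting M e"
    using e \<open>0 < t\<close> by (intro uniquely_projecting_of_less_reach) auto
  from nearest_ray_extends[OF assms(1) this assms(4-6) \<open>0 < t\<close> e(1)]
  have "2 * t * I \<le> (dist a b)\<^sup>2"
    unfolding I_def using assms \<open>0 < t\<close> by (intro inner_le_of_nearest) auto
  with t(1) I show False by (simp add: field_simps)
qed

section \<open>Projected midpoints\<close>

text \<open>The hypothesis is equivalent to \<open>cos \<theta> \<le> cos (\<alpha> + \<beta>) cos (\<alpha> - \<beta>)\<close>, and \<open>cos (\<alpha> - \<beta>)\<close> lies in \<open>[0, 1]\<close>.\<close>

lemma add_angles_le:
  fixes \<theta> \<alpha> \<beta> :: real
  assumes \<theta>: "0 \<le> \<theta>" "\<theta> < pi / 2" and \<alpha>: "0 \<le> \<alpha>" "\<alpha> \<le> pi / 2" and \<beta>: "0 \<le> \<beta>" "\<beta> \<le> pi / 2"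
    and sins: "(sin \<alpha>)\<^sup>2 + (sin \<beta>)\<^sup>2 \<le> 1 - cos \<theta>"
  shows "\<alpha> + \<beta> \<le> \<theta>"
proof (rule ccontr)
  assume "\<not> \<alpha> + \<beta> \<le> \<theta>"
  then have less: "cos (\<alpha> + \<beta>) < cos \<theta>"
    using \<theta> \<alpha> \<beta> by (intro cos_monotone_0_pi) auto
  have "cos (\<alpha> + \<beta>) * cos (\<alpha> - \<beta>) = (cos \<alpha>)\<^sup>2 * (cos \<beta>)\<^sup>2 - (sin \<alpha>)\<^sup>2 * (sin \<beta>)\<^sup>2"
    by (simp add: cos_add cos_diff power2_eq_square algebra_simps)
  also have "\<dots> = 1 - ((sin \<alpha>)\<^sup>2 + (sin \<beta>)\<^sup>2)"
    by (simp add: cos_squared_eq algebra_simps)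
  finally have le: "cos \<theta> \<le> cos (\<alpha> + \<beta>) * cos (\<alpha> - \<beta>)" using sins by simp
  have pos: "0 < cos \<theta>" using \<theta> by (intro cos_gt_zero_pi) auto
  have d: "0 \<le> cos (\<alpha> - \<beta>)" using \<alpha> \<beta> by (intro cos_ge_zero) auto
  show False
  proof (cases "cos (\<alpha> + \<beta>) \<le> 0")
    case True
    then have "cos (\<alpha> + \<beta>) * cos (\<alpha> - \<beta>) \<le> 0" using d by (rule mult_nonpos_nonneg)
    with le pos show False by linarith
  next
    case False
    then have "cos (\<alpha> + \<beta>) * cos (\<alpha> - \<beta>) \<le> cos (\<alpha> + \<beta>) * 1"
      by (intro mult_left_mono) auto
    with le less show False by linarith
  qed
qed

text \<open>Length of the minor arc of a circle of radius \<open>\<alpha>\<close> over a chord of length \<open>r\<close>.\<close>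

definition arc_bound :: "real \<Rightarrow> real \<Rightarrow> real" where
  "arc_bound \<alpha> r = 2 * \<alpha> * arcsin (r / (2 * \<alpha>))"

lemma le_arc_bound:
  assumes "0 < \<alpha>" "0 \<le> r" "r \<le> 2 * \<alpha>"
  shows "r \<le> arc_bound \<alpha> r"
proof -
  have s: "0 \<le> r / (2 * \<alpha>)" "r / (2 * \<alpha>) \<le> 1" using assms by auto
  have "r / (2 * \<alpha>) = sin (arcsin (r / (2 * \<alpha>)))" using s by (intro sin_arcsin[symmetric]) auto
  also have "\<dots> \<le> arcsin (r / (2 * \<alpha>))" using s by (intro sin_x_le_x arcsin_nonneg) auto
  finally show ?thesis using assms by (simp add: arc_bound_def field_simps)
qed

lemma arc_bound_le_pi_half:
  assumes "0 < \<alpha>" "0 \<le> r" "r \<le> 2 * \<alpha>"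
  shows "arc_bound \<alpha> r \<le> pi / 2 * r"
proof -
  define s where "s = r / (2 * \<alpha>)"
  have s: "0 \<le> s" "s \<le> 1" using assms by (auto simp: s_def)
  define t where "t = arcsin s"
  have t: "0 \<le> t" "t \<le> pi / 2" "sin t = s"
    using s arcsin_bounded[of s] arcsin_nonneg[of s] by (auto simp: t_def)
  have "2 / pi * t \<le> sin t"
  proof -
    have "convex_on {0..pi} (\<lambda>x. - sin x :: real)"
      by (rule f''_ge0_imp_convex[where f' = "\<lambda>x. - cos x" and f'' = sin])
        (auto intro!: derivative_eq_intros sin_ge_zero)
    from convex_onD[OF this, of "2 * t / pi" 0 "pi / 2"] show ?thesis
      using t by (simp add: field_simps)
  qed
  then have "t \<le> pi / 2 * s" using t by (simp add: field_simps)
  then show ?thesis using assms by (simp add: arc_bound_def s_def t_def field_simps)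
qed

text \<open>In terms of \<open>s = r / (2 \<alpha>)\<close> the claim is \<open>arcsin s \<le> s + c s\<^sup>2\<close> on \<open>[0, 1/2]\<close> with
\<open>c = 2 / (3 \<surd>3)\<close>; here \<open>2 c\<close> is the maximum \<open>4 / (3 \<surd>3)\<close> of the second derivative
\<open>s / (1 - s\<^sup>2)\<^sup>3\<^sup>/\<^sup>2\<close>. The difference of both sides is shown to be increasing, for which \<open>c > 1/3\<close> is enough.\<close>

lemma arc_bound_quadratic:
  assumes "0 < \<alpha>" "0 \<le> r" "r \<le> \<alpha>"
  shows "arc_bound \<alpha> r \<le> r + 1 / (3 * \<alpha> * sqrt 3) * r\<^sup>2"
proof -
  define s where "s = r / (2 * \<alpha>)"
  have s: "0 \<le> s" "s \<le> 1 / 2" using assms by (auto simp: s_def)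
  define c where "c = 2 / (3 * sqrt 3)"
  have "sqrt 3 < 2" by (rule real_less_lsqrt) auto
  then have c: "1 / 3 < c" by (simp add: c_def field_simps)
  define h where "h = (\<lambda>x. x + c * x\<^sup>2 - arcsin x)"
  have "h 0 \<le> h s"
  proof (rule DERIV_nonneg_imp_nondecreasing[OF s(1)])
    fix x assume x: "0 \<le> x" "x \<le> s"
    then have x1: "0 \<le> x" "x \<le> 1 / 2" using s by auto
    have "(h has_real_derivative 1 + 2 * c * x - inverse (sqrt (1 - x\<^sup>2))) (at x)"
      unfolding h_def using x1 by (auto intro!: derivative_eq_intros)
    moreover have "inverse (sqrt (1 - x\<^sup>2)) \<le> 1 + 2 * c * x"
    proof -
      have x2: "x\<^sup>2 \<le> 1 / 4" using power_mono[OF x1(2,1), of 2] by (simp add: power2_eq_square)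
      have "x * x \<le> 1 / 2 * x" using x1 by (intro mult_right_mono) auto
      have "(4 * c * x) * (3 / 4) \<le> (4 * c * x) * (1 - x\<^sup>2)"
        using x1 x2 c by (intro mult_left_mono) auto
      moreover have "x \<le> 3 * c * x" using c x1 by (intro mult_right_mono[of 1 "3 * c" x, simplified]) auto
      ultimately have "1 \<le> (1 + 4 * c * x) * (1 - x\<^sup>2)"
        using \<open>x * x \<le> 1 / 2 * x\<close> x1 by (simp add: algebra_simps power2_eq_square)
      also have "\<dots> \<le> (1 + 2 * c * x)\<^sup>2 * (1 - x\<^sup>2)"
        using x2 zero_le_power2[of "c * x"]
        by (intro mult_right_mono) (auto simp: power2_eq_square algebra_simps)
      finally have "1\<^sup>2 \<le> ((1 + 2 * c * x) * sqrt (1 - x\<^sup>2))\<^sup>2"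
        using x2 by (simp add: power_mult_distrib)
      then have "1 \<le> (1 + 2 * c * x) * sqrt (1 - x\<^sup>2)"
        by (rule power2_le_imp_le) (use x1 x2 c in auto)
      moreover have "0 < sqrt (1 - x\<^sup>2)" using x2 by simp
      ultimately show ?thesis by (simp add: field_simps)
    qed
    ultimately show "\<exists>y. (h has_real_derivative y) (at x) \<and> 0 \<le> y" by force
  qed
  then have "arcsin s \<le> s + c * s\<^sup>2" by (simp add: h_def)
  then have "2 * \<alpha> * arcsin s \<le> 2 * \<alpha> * (s + c * s\<^sup>2)" using assms by (intro mult_left_mono) auto
  also have "\<dots> = r + 1 / (3 * \<alpha> * sqrt 3) * r\<^sup>2"
    using assms by (simp add: s_def c_def power2_eq_square field_simps)
  finally show ?thesis by (simp add: arc_bound_def s_def)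
qed

text \<open>Let \<open>l\<close> be half the distance of \<open>a\<close> and \<open>b\<close>, and \<open>h\<close> the distance from their midpoint to its projection
\<open>p\<close>. The touching ball of radius \<open>\<alpha>\<close> at \<open>p\<close> contains neither \<open>a\<close> nor \<open>b\<close> in its interior; averaging the two
inequalities gives \<open>2 \<alpha> h \<le> h\<^sup>2 + l\<^sup>2\<close>. As \<open>h \<le> l < \<alpha>\<close>, the number \<open>h\<close> is at most the smaller root, which is the
height of the circular arc of radius \<open>\<alpha>\<close> over a chord of length \<open>2 l\<close>. The parallelogram law turns this into
a bound for the sum of squares; equality holds for the midpoint of the arc.\<close>

lemma projected_midpoint:
  fixes M :: "'a::euclidean_space set"
  assumes comp: "compact M" and \<alpha>: "0 < \<alpha>" "ereal \<alpha> \<le> reach M"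
    and ab: "a \<in> M" "b \<in> M" and d: "dist a b < 2 * \<alpha>"
  shows "\<exists>p\<in>M. (dist a p)\<^sup>2 + (dist p b)\<^sup>2 \<le> 4 * \<alpha>\<^sup>2 * (1 - sqrt (1 - (dist a b / (2 * \<alpha>))\<^sup>2))"
proof -
  define x where "x = midpoint a b"
  define l where "l = dist a b / 2"
  obtain p where p: "nearest M x p" using nearest_exists[OF comp] ab by blast
  then have pM: "p \<in> M" and near: "\<And>q. q \<in> M \<Longrightarrow> dist x p \<le> dist x q" by (auto simp: nearest_def)
  define h where "h = dist x p"
  have hl: "h \<le> l" using near[OF ab(1)] by (simp add: h_def l_def x_def dist_midpoint)
  have l: "0 \<le> l" "l < \<alpha>" using d by (auto simp: l_def)
  have h: "0 \<le> h" by (simp add: h_def)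
  have ap: "a - p = (x - p) + (a - b) /\<^sub>R 2" and bp: "b - p = (x - p) - (a - b) /\<^sub>R 2"
  proof -
    have half: "(1 / 2) *\<^sub>R v + (1 / 2) *\<^sub>R v = v" for v :: 'a
      by (simp flip: scaleR_left_distrib)
    show "a - p = (x - p) + (a - b) /\<^sub>R 2" "b - p = (x - p) - (a - b) /\<^sub>R 2"
      unfolding x_def midpoint_def using half[of a] half[of b] by (simp_all add: algebra_simps)
  qed
  have "(norm (a - p))\<^sup>2 + (norm (b - p))\<^sup>2 = 2 * (norm (x - p))\<^sup>2 + 2 * (norm ((a - b) /\<^sub>R 2))\<^sup>2"
    unfolding ap bp power2_norm_eq_inner by (simp add: inner_diff_left inner_diff_right inner_add_left inner_add_right inner_commute)
  then have Q: "(dist a p)\<^sup>2 + (dist p b)\<^sup>2 = 2 * h\<^sup>2 + 2 * l\<^sup>2"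
    by (simp add: dist_norm h_def l_def norm_minus_commute)
  have quad: "2 * \<alpha> * h \<le> h\<^sup>2 + l\<^sup>2"
  proof (cases "h = 0")
    case False
    then have hpos: "0 < h" using h by simp
    define u where "u = (x - p) /\<^sub>R h"
    have u: "norm u = 1" using hpos by (simp add: u_def h_def dist_norm)
    have xp: "x = p + h *\<^sub>R u" using hpos by (simp add: u_def)
    have np: "nearest M (p + h *\<^sub>R u) p" using p xp by simp
    have "2 * \<alpha> * (u \<bullet> (a - p)) \<le> (dist p a)\<^sup>2" "2 * \<alpha> * (u \<bullet> (b - p)) \<le> (dist p b)\<^sup>2"
      by (rule reach_inner_bound[OF comp \<alpha>(2,1) u hpos np], fact ab)+
    then have "2 * \<alpha> * (u \<bullet> (a - p) + u \<bullet> (b - p)) \<le> 2 * h\<^sup>2 + 2 * l\<^sup>2"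
      using Q by (simp add: dist_commute ring_distribs)
    also have "u \<bullet> (a - p) + u \<bullet> (b - p) = 2 * (u \<bullet> (x - p))"
      unfolding ap bp by (simp add: inner_add_right inner_diff_right)
    also have "x - p = h *\<^sub>R u" using xp by simp
    also have "u \<bullet> (h *\<^sub>R u) = h" using u by (simp add: norm_eq_1)
    finally show ?thesis by simp
  qed simp
  define c where "c = sqrt (1 - (l / \<alpha>)\<^sup>2)"
  have "(l / \<alpha>)\<^sup>2 \<le> 1" using l by (intro power_le_one) auto
  then have c: "c\<^sup>2 = 1 - (l / \<alpha>)\<^sup>2" by (simp add: c_def)
  then have l2: "l\<^sup>2 = \<alpha>\<^sup>2 * (1 - c\<^sup>2)" using \<alpha> by (simp add: power_divide field_simps)
  have "(\<alpha> * c)\<^sup>2 \<le> (\<alpha> - h)\<^sup>2"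
    using quad l2 by (simp add: power2_diff power_mult_distrib algebra_simps)
  then have "\<alpha> * c \<le> \<alpha> - h" by (rule power2_le_imp_le) (use hl l in auto)
  then have "h \<le> \<alpha> * (1 - c)" by (simp add: algebra_simps)
  then have "h\<^sup>2 \<le> \<alpha>\<^sup>2 * (1 - c)\<^sup>2" using power_mono[of h "\<alpha> * (1 - c)" 2] h by (simp add: power_mult_distrib)
  then have "2 * h\<^sup>2 + 2 * l\<^sup>2 \<le> 4 * \<alpha>\<^sup>2 * (1 - c)"
    unfolding l2 by (simp add: power2_eq_square algebra_simps)
  moreover have "l / \<alpha> = dist a b / (2 * \<alpha>)" by (simp add: l_def)
  ultimately show ?thesis using Q pM unfolding c_def by (intro bexI[of _ p]) auto
qed

text \<open>With \<open>\<theta>\<close> the half-angle of the arc over the chord from \<open>a\<close> to \<open>b\<close>, the bound for the sum of squares is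
exactly what \<open>add_angles_le\<close> requires, although \<open>p\<close> need not be equidistant from \<open>a\<close> and \<open>b\<close>. It also
bounds each of the two new distances by \<open>dist a b / sqrt (1 + cos \<theta>)\<close>, a contraction that is uniform as
long as \<open>dist a b \<le> r < 2 * \<alpha>\<close>.\<close>

lemma arc_midpoint:
  fixes M :: "'a::euclidean_space set"
  assumes comp: "compact M" and \<alpha>: "0 < \<alpha>" "ereal \<alpha> \<le> reach M"
    and ab: "a \<in> M" "b \<in> M" and d: "dist a b \<le> r" "r < 2 * \<alpha>"
  defines "\<kappa> \<equiv> sqrt (1 / (1 + sqrt (1 - (r / (2 * \<alpha>))\<^sup>2)))"
  shows "\<exists>p\<in>M. dist a p \<le> \<kappa> * dist a b \<and> dist p b \<le> \<kappa> * dist a b \<and>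
    arc_bound \<alpha> (dist a p) + arc_bound \<alpha> (dist p b) \<le> arc_bound \<alpha> (dist a b)"
proof -
  define s where "s = dist a b / (2 * \<alpha>)"
  have s: "0 \<le> s" "s < 1" "s \<le> r / (2 * \<alpha>)" using d \<alpha> by (auto simp: s_def divide_right_mono)
  define \<theta> where "\<theta> = arcsin s"
  have \<theta>: "0 \<le> \<theta>" "\<theta> < pi / 2" "sin \<theta> = s"
    using s arcsin_nonneg[of s] arcsin_less_arcsin[of s 1] by (auto simp: \<theta>_def arcsin_1)
  have cos\<theta>: "cos \<theta> = sqrt (1 - s\<^sup>2)" using s by (simp add: \<theta>_def cos_arcsin)
  obtain p where p: "p \<in> M" and Q: "(dist a p)\<^sup>2 + (dist p b)\<^sup>2 \<le> 4 * \<alpha>\<^sup>2 * (1 - cos \<theta>)"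
    using projected_midpoint[OF comp \<alpha> ab] d unfolding cos\<theta> s_def by fastforce
  have c0: "0 < cos \<theta>" using \<theta> by (intro cos_gt_zero_pi) auto
  have short: "q \<le> \<kappa> * dist a b" if q: "q\<^sup>2 \<le> 4 * \<alpha>\<^sup>2 * (1 - cos \<theta>)" for q
  proof (rule power2_le_imp_le)
    have "s\<^sup>2 \<le> (r / (2 * \<alpha>))\<^sup>2" using s by (intro power_mono) auto
    then have cr: "sqrt (1 - (r / (2 * \<alpha>))\<^sup>2) \<le> cos \<theta>" unfolding cos\<theta> by simp
    have "0 \<le> r / (2 * \<alpha>)" "r / (2 * \<alpha>) \<le> 1" using d \<alpha> s by auto
    then have "(r / (2 * \<alpha>))\<^sup>2 \<le> 1" by (intro power_le_one) auto
    then have r0: "0 \<le> sqrt (1 - (r / (2 * \<alpha>))\<^sup>2)" by simp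
    have "4 * \<alpha>\<^sup>2 * (1 - cos \<theta>) = (4 * \<alpha>\<^sup>2 * (1 - (cos \<theta>)\<^sup>2)) / (1 + cos \<theta>)"
      using c0 by (simp add: field_simps power2_eq_square)
    also have "4 * \<alpha>\<^sup>2 * (1 - (cos \<theta>)\<^sup>2) = (dist a b)\<^sup>2"
      using \<alpha> \<theta> unfolding sin_squared_eq[symmetric] by (simp add: s_def power_divide)
    also have "(dist a b)\<^sup>2 / (1 + cos \<theta>) \<le> (dist a b)\<^sup>2 / (1 + sqrt (1 - (r / (2 * \<alpha>))\<^sup>2))"
      using cr r0 c0 by (intro divide_left_mono mult_pos_pos add_pos_nonneg) auto
    also have "\<dots> = (\<kappa> * dist a b)\<^sup>2" using r0 by (simp add: \<kappa>_def power_mult_distrib)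
    finally show "q\<^sup>2 \<le> (\<kappa> * dist a b)\<^sup>2" using q by linarith
    show "0 \<le> \<kappa> * dist a b" using r0 by (simp add: \<kappa>_def)
  qed
  have small: "dist a p / (2 * \<alpha>) \<le> 1" "dist p b / (2 * \<alpha>) \<le> 1"
  proof -
    have "4 * \<alpha>\<^sup>2 * (1 - cos \<theta>) \<le> 4 * \<alpha>\<^sup>2 * 1" using c0 by (intro mult_left_mono) auto
    also have "\<dots> = (2 * \<alpha>)\<^sup>2" by (simp add: power_mult_distrib)
    finally have "(dist a p)\<^sup>2 \<le> (2 * \<alpha>)\<^sup>2" "(dist p b)\<^sup>2 \<le> (2 * \<alpha>)\<^sup>2"
      using Q zero_le_power2[of "dist a p"] zero_le_power2[of "dist p b"] by linarith+
    then have "dist a p \<le> 2 * \<alpha>" "dist p b \<le> 2 * \<alpha>" using \<alpha> by (auto intro: power2_le_imp_le)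
    then show "dist a p / (2 * \<alpha>) \<le> 1" "dist p b / (2 * \<alpha>) \<le> 1" using \<alpha> by auto
  qed
  have nn: "0 \<le> dist a p / (2 * \<alpha>)" "0 \<le> dist p b / (2 * \<alpha>)" using \<alpha> by auto
  have "arcsin (dist a p / (2 * \<alpha>)) + arcsin (dist p b / (2 * \<alpha>)) \<le> \<theta>"
  proof (rule add_angles_le[OF \<theta>(1,2)])
    have "(dist a p / (2 * \<alpha>))\<^sup>2 + (dist p b / (2 * \<alpha>))\<^sup>2 = ((dist a p)\<^sup>2 + (dist p b)\<^sup>2) / (4 * \<alpha>\<^sup>2)"
      by (simp add: power_divide power_mult_distrib add_divide_distrib)
    also have "\<dots> \<le> 4 * \<alpha>\<^sup>2 * (1 - cos \<theta>) / (4 * \<alpha>\<^sup>2)" by (intro divide_right_mono Q) simp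
    also have "\<dots> = 1 - cos \<theta>" using \<alpha> by simp
    finally show "(sin (arcsin (dist a p / (2 * \<alpha>))))\<^sup>2 + (sin (arcsin (dist p b / (2 * \<alpha>))))\<^sup>2 \<le> 1 - cos \<theta>"
      using small nn by simp
  qed (use small nn arcsin_bounded arcsin_nonneg in auto)
  then have "2 * \<alpha> * (arcsin (dist a p / (2 * \<alpha>)) + arcsin (dist p b / (2 * \<alpha>))) \<le> 2 * \<alpha> * \<theta>"
    using \<alpha> by (intro mult_left_mono) auto
  then have "arc_bound \<alpha> (dist a p) + arc_bound \<alpha> (dist p b) \<le> arc_bound \<alpha> (dist a b)"
    by (simp add: arc_bound_def \<theta>_def s_def ring_distribs)
  moreover have "dist a p \<le> \<kappa> * dist a b" "dist p b \<le> \<kappa> * dist a b"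
    using Q zero_le_power2[of "dist a p"] zero_le_power2[of "dist p b"] by (intro short; linarith)+
  ultimately show ?thesis using p by blast
qed

section \<open>Curves in sets of positive reach\<close>

text \<open>A set with approximate midpoints contains a curve between any two of its points that are close enough.
The function \<open>A\<close> is a substitute for length that does not increase when a midpoint is inserted; \<open>\<kappa>\<close> makes
the distances of consecutive points decay geometrically.\<close>

context
  fixes S :: "'a::euclidean_space set" and mid :: "'a \<Rightarrow> 'a \<Rightarrow> 'a" and A :: "'a \<Rightarrow> 'a \<Rightarrow> real"
    and \<kappa> r :: real
  assumes S: "closed S" and \<kappa>: "0 \<le> \<kappa>" "\<kappa> < 1"
    and mid_in: "\<And>a b. a \<in> S \<Longrightarrow> b \<in> S \<Longrightarrow> dist a b \<le> r \<Longrightarrow> mid a b \<in> S"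
    and mid_left: "\<And>a b. a \<in> S \<Longrightarrow> b \<in> S \<Longrightarrow> dist a b \<le> r \<Longrightarrow> dist a (mid a b) \<le> \<kappa> * dist a b"
    and mid_right: "\<And>a b. a \<in> S \<Longrightarrow> b \<in> S \<Longrightarrow> dist a b \<le> r \<Longrightarrow> dist (mid a b) b \<le> \<kappa> * dist a b"
    and mid_add: "\<And>a b. a \<in> S \<Longrightarrow> b \<in> S \<Longrightarrow> dist a b \<le> r \<Longrightarrow> A a (mid a b) + A (mid a b) b \<le> A a b"
    and dist_le_A: "\<And>a b. a \<in> S \<Longrightarrow> b \<in> S \<Longrightarrow> dist a b \<le> r \<Longrightarrow> dist a b \<le> A a b"
begin

context
  fixes a b :: 'a
  assumes ab: "a \<in> S" "b \<in> S" "dist a b \<le> r"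
begin

text \<open>The value \<open>dyadic k i\<close> is the point of parameter \<open>i / 2\<^sup>k\<close> after \<open>k\<close> refinements. From
index \<open>2\<^sup>k\<close> on, all values are \<open>b\<close>, which spares index bounds in the lemmas.\<close>

primrec dyadic :: "nat \<Rightarrow> nat \<Rightarrow> 'a" where
  "dyadic 0 = (\<lambda>i. if i = 0 then a else b)"
| "dyadic (Suc k) = (\<lambda>i. if even i then dyadic k (i div 2) else mid (dyadic k (i div 2)) (dyadic k (Suc (i div 2))))"

lemma r_nonneg: "0 \<le> r"
  using ab(3) zero_le_dist[of a b] by linarith

lemma dyadic_props: "dyadic k i \<in> S \<and> dist (dyadic k i) (dyadic k (Suc i)) \<le> \<kappa> ^ k * r"
proof (induction k arbitrary: i)
  case 0
  then show ?case using ab r_nonneg by auto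
next
  case (Suc k)
  have le: "\<kappa> ^ k * r \<le> r"
    using \<kappa> r_nonneg by (intro mult_left_le_one_le power_le_one) auto
  define c d where "c = dyadic k (i div 2)" and "d = dyadic k (Suc (i div 2))"
  have cd: "c \<in> S" "d \<in> S" "dist c d \<le> \<kappa> ^ k * r"
    using Suc unfolding c_def d_def by blast+
  have small: "dist c d \<le> r" using cd(3) le by linarith
  have \<kappa>cd: "\<kappa> * dist c d \<le> \<kappa> ^ Suc k * r" using mult_left_mono[OF cd(3) \<kappa>(1)] by (simp add: mult.assoc)
  show ?case
  proof (cases "even i")
    case True
    then show ?thesis
      using mid_left[OF cd(1,2) small] \<kappa>cd cd(1) by (simp add: c_def d_def)
  next
    case False
    then have "Suc i div 2 = Suc (i div 2)" by presburger
    with False show ?thesis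
      using mid_right[OF cd(1,2) small] mid_in[OF cd(1,2) small] \<kappa>cd by (simp add: c_def d_def)
  qed
qed

lemma dyadic_in: "dyadic k i \<in> S"
  and dyadic_step: "dist (dyadic k i) (dyadic k (Suc i)) \<le> \<kappa> ^ k * r"
  using dyadic_props by auto

lemma dyadic_step_r: "dist (dyadic k i) (dyadic k (Suc i)) \<le> r"
proof -
  have "\<kappa> ^ k * r \<le> r" using \<kappa> r_nonneg by (intro mult_left_le_one_le power_le_one) auto
  with dyadic_step[of k i] show ?thesis by linarith
qed

lemma sum_dyadic_le: "(\<Sum>i<2 ^ k. A (dyadic k i) (dyadic k (Suc i))) \<le> A a b"
proof (induction k)
  case (Suc k)
  let ?F = "\<lambda>i. A (dyadic (Suc k) i) (dyadic (Suc k) (Suc i))"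
  have split: "(\<Sum>i<2 * n. h i) = (\<Sum>i<n. h (2 * i) + h (Suc (2 * i)))" for n and h :: "nat \<Rightarrow> real"
    by (induction n) auto
  have "(\<Sum>i<2 ^ Suc k. ?F i) = (\<Sum>i<2 ^ k. ?F (2 * i) + ?F (Suc (2 * i)))"
    unfolding power_Suc by (rule split)
  also have "\<dots> \<le> (\<Sum>i<2 ^ k. A (dyadic k i) (dyadic k (Suc i)))"
    by (intro sum_mono) (use mid_add[OF dyadic_in dyadic_in dyadic_step_r] in simp)
  finally show ?case using Suc by linarith
qed simp

lemma dyadic_refine: "dyadic (k + n) (i * 2 ^ n) = dyadic k i"
proof (induction n)
  case (Suc n)
  have "i * 2 ^ Suc n div 2 = i * 2 ^ n" by simp
  with Suc show ?case by simp
qed simp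

text \<open>The step functions through the points of one generation take values in \<open>S\<close>, unlike polygons; the
continuity of their uniform limit comes from their jumps tending to \<open>0\<close>.\<close>

definition dyadic_step_fun :: "nat \<Rightarrow> real \<Rightarrow> 'a" where
  "dyadic_step_fun k t = dyadic k (nat \<lfloor>2 ^ k * t\<rfloor>)"

lemma dyadic_step_fun_Suc:
  assumes "0 \<le> t"
  shows "dist (dyadic_step_fun k t) (dyadic_step_fun (Suc k) t) \<le> \<kappa> ^ k * r"
proof -
  define i where "i = nat \<lfloor>2 ^ k * t\<rfloor>"
  have "real i \<le> 2 ^ k * t" "2 ^ k * t < real i + 1"
    using assms unfolding i_def by (auto simp: of_nat_nat)
  then have "2 * real i \<le> 2 ^ Suc k * t" "2 ^ Suc k * t < 2 * real i + 2" by auto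
  then have "nat \<lfloor>2 ^ Suc k * t\<rfloor> = 2 * i \<or> nat \<lfloor>2 ^ Suc k * t\<rfloor> = Suc (2 * i)"
    by linarith
  then show ?thesis
  proof
    assume "nat \<lfloor>2 ^ Suc k * t\<rfloor> = 2 * i"
    then show ?thesis using \<kappa> r_nonneg unfolding dyadic_step_fun_def i_def[symmetric] by simp
  next
    assume "nat \<lfloor>2 ^ Suc k * t\<rfloor> = Suc (2 * i)"
    then have "dist (dyadic_step_fun k t) (dyadic_step_fun (Suc k) t)
        = dist (dyadic k i) (mid (dyadic k i) (dyadic k (Suc i)))"
      unfolding dyadic_step_fun_def i_def[symmetric] by simp
    also have "\<dots> \<le> \<kappa> * dist (dyadic k i) (dyadic k (Suc i))"
      by (rule mid_left[OF dyadic_in dyadic_in dyadic_step_r])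
    also have "\<dots> \<le> 1 * dist (dyadic k i) (dyadic k (Suc i))"
      using \<kappa> by (intro mult_right_mono) auto
    also have "\<dots> \<le> \<kappa> ^ k * r" using dyadic_step by simp
    finally show ?thesis .
  qed
qed

lemma dyadic_step_fun_close:
  assumes "0 \<le> s" "s \<le> t" "t - s < 1 / 2 ^ k"
  shows "dist (dyadic_step_fun k s) (dyadic_step_fun k t) \<le> \<kappa> ^ k * r"
proof -
  have "2 ^ k * s \<le> 2 ^ k * t" "2 ^ k * t < 2 ^ k * s + 1" "0 \<le> 2 ^ k * s"
    using assms by (auto simp: field_simps)
  then have "nat \<lfloor>2 ^ k * t\<rfloor> = nat \<lfloor>2 ^ k * s\<rfloor> \<or> nat \<lfloor>2 ^ k * t\<rfloor> = Suc (nat \<lfloor>2 ^ k * s\<rfloor>)"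
    by linarith
  then show ?thesis
    unfolding dyadic_step_fun_def using dyadic_step \<kappa> r_nonneg by auto
qed

lemma dyadic_step_fun_uniform_limit:
  "\<exists>f. uniform_limit {0..1} dyadic_step_fun f sequentially"
proof -
  have "uniform_limit {0..1} (\<lambda>n t. \<Sum>i<n. dyadic_step_fun (Suc i) t - dyadic_step_fun i t)
      (\<lambda>t. \<Sum>i. dyadic_step_fun (Suc i) t - dyadic_step_fun i t) sequentially"
  proof (rule Weierstrass_m_test)
    show "norm (dyadic_step_fun (Suc i) t - dyadic_step_fun i t) \<le> \<kappa> ^ i * r" if "t \<in> {0..1}" for i t
      using dyadic_step_fun_Suc[of t i] that by (simp add: dist_norm norm_minus_commute)
    show "summable (\<lambda>i. \<kappa> ^ i * r)" using \<kappa> by (intro summable_mult2 summable_geometric) auto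
  qed
  then have "uniform_limit {0..1} (\<lambda>n t. dyadic_step_fun 0 t + (\<Sum>i<n. dyadic_step_fun (Suc i) t - dyadic_step_fun i t))
      (\<lambda>t. dyadic_step_fun 0 t + (\<Sum>i. dyadic_step_fun (Suc i) t - dyadic_step_fun i t)) sequentially"
    by (intro uniform_limit_intros)
  moreover have "dyadic_step_fun 0 t + (\<Sum>i<n. dyadic_step_fun (Suc i) t - dyadic_step_fun i t) = dyadic_step_fun n t" for n t
    by (simp add: sum_lessThan_telescope[of "\<lambda>i. dyadic_step_fun i t"])
  ultimately show ?thesis by auto
qed

text \<open>The limit curve interpolates all dyadic points, so its length is the limit of its dyadic grid sums, and
these are bounded by the sums of \<open>A\<close>.\<close>

lemma dyadic_curve:
  "\<exists>g. path g \<and> path_image g \<subseteq> S \<and> pathstart g = a \<and> pathfinish g = b \<and> curve_length g \<le> ereal (A a b)"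
proof -
  obtain f where f: "uniform_limit {0..1} dyadic_step_fun f sequentially"
    using dyadic_step_fun_uniform_limit by blast
  have lim: "(\<lambda>k. dyadic_step_fun k t) \<longlonglongrightarrow> f t" if "t \<in> {0..1}" for t
    using tendsto_uniform_limitI[OF f that] .
  have val: "f (real i / 2 ^ k) = dyadic k i" if "i \<le> 2 ^ k" for i k
  proof (rule LIMSEQ_unique[OF lim])
    have "dyadic_step_fun n (real i / 2 ^ k) = dyadic k i" if "k \<le> n" for n
    proof -
      have "2 ^ n * (real i / 2 ^ k) = real (i * 2 ^ (n - k))"
        using that by (simp add: field_simps flip: power_add)
      then have "nat \<lfloor>2 ^ n * (real i / 2 ^ k)\<rfloor> = i * 2 ^ (n - k)" by (simp only: floor_of_nat nat_int)
      then show ?thesis unfolding dyadic_step_fun_def using dyadic_refine[of k "n - k" i] that by simp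
    qed
    then have "\<forall>\<^sub>F n in sequentially. dyadic_step_fun n (real i / 2 ^ k) = dyadic k i"
      by (auto simp: eventually_sequentially)
    then show "(\<lambda>n. dyadic_step_fun n (real i / 2 ^ k)) \<longlonglongrightarrow> dyadic k i" by (rule tendsto_eventually)
    show "real i / 2 ^ k \<in> {0..1}" using of_nat_mono[OF that, where ?'a = real] by simp
  qed
  have cont: "uniformly_continuous_on {0..1} f"
    unfolding uniformly_continuous_on_def
  proof (intro allI impI)
    fix e :: real assume e: "0 < e"
    have "(\<lambda>k. \<kappa> ^ k * r) \<longlonglongrightarrow> 0 * r" using \<kappa> by (intro tendsto_mult_right LIMSEQ_power_zero) auto
    then have "\<forall>\<^sub>F k in sequentially. \<kappa> ^ k * r < e / 3" using e by (intro order_tendstoD(2)) auto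
    moreover have "\<forall>\<^sub>F k in sequentially. \<forall>t\<in>{0..1}. dist (dyadic_step_fun k t) (f t) < e / 3"
      using uniform_limitD[OF f, of "e / 3"] e by simp
    ultimately obtain k where k: "\<kappa> ^ k * r < e / 3" "\<And>t. t \<in> {0..1} \<Longrightarrow> dist (dyadic_step_fun k t) (f t) < e / 3"
      using eventually_conj[THEN eventually_happens'[OF sequentially_bot]] by (metis (no_types, lifting))
    have *: "dist (f s) (f t) < e" if "s \<in> {0..1}" "t \<in> {0..1}" "s \<le> t" "t - s < 1 / 2 ^ k" for s t
    proof -
      have "dist (dyadic_step_fun k s) (dyadic_step_fun k t) < e / 3"
        using dyadic_step_fun_close[of s t k] that k(1) by simp
      moreover have "dist (f s) (f t) \<le> dist (dyadic_step_fun k s) (f s) +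
          (dist (dyadic_step_fun k s) (dyadic_step_fun k t) + dist (dyadic_step_fun k t) (f t))"
        using dist_triangle3[of "f s" "f t" "dyadic_step_fun k s"]
          dist_triangle[of "dyadic_step_fun k s" "f t" "dyadic_step_fun k t"] by linarith
      ultimately show ?thesis using k(2)[OF that(1)] k(2)[OF that(2)] by linarith
    qed
    have "dist (f t) (f s) < e" if "s \<in> {0..1}" "t \<in> {0..1}" "dist t s < 1 / 2 ^ k" for s t
      using *[of s t] *[of t s] that by (cases "s \<le> t") (auto simp: dist_real_def dist_commute)
    then show "\<exists>d>0. \<forall>x\<in>{0..1}. \<forall>x'\<in>{0..1}. dist x' x < d \<longrightarrow> dist (f x') (f x) < e"
      by (intro exI[of _ "1 / 2 ^ k"]) auto
  qed
  have path: "path f" unfolding path_def by (rule uniformly_continuous_imp_continuous[OF cont])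
  have "f t \<in> S" if "t \<in> {0..1}" for t
    by (rule closed_sequentially[OF S _ lim[OF that]]) (simp add: dyadic_step_fun_def dyadic_in)
  then have image: "path_image f \<subseteq> S" unfolding path_image_def by auto
  have "curve_length f \<le> ereal (A a b)"
  proof (rule curve_length_le_of_grid[OF path])
    fix \<delta> :: real and m\<^sub>0 :: nat
    assume "0 < \<delta>"
    have "grid_length f (2 ^ m\<^sub>0) = (\<Sum>i<2 ^ m\<^sub>0. dist (dyadic m\<^sub>0 i) (dyadic m\<^sub>0 (Suc i)))"
      unfolding grid_length_def
      by (intro sum.cong refl arg_cong2[where f = dist]) (use val[of _ m\<^sub>0] in \<open>auto simp del: of_nat_Suc\<close>)
    also have "\<dots> \<le> (\<Sum>i<2 ^ m\<^sub>0. A (dyadic m\<^sub>0 i) (dyadic m\<^sub>0 (Suc i)))"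
      by (intro sum_mono dist_le_A dyadic_in dyadic_step_r)
    also have "\<dots> \<le> A a b" by (rule sum_dyadic_le)
    finally have "grid_length f (2 ^ m\<^sub>0) \<le> A a b + \<delta>" using \<open>0 < \<delta>\<close> by simp
    moreover have "m\<^sub>0 \<le> 2 ^ m\<^sub>0" by (simp add: less_imp_le)
    ultimately show "\<exists>m\<ge>m\<^sub>0. grid_length f m \<le> A a b + \<delta>" by blast
  qed
  moreover have "pathstart f = a" "pathfinish f = b"
    using val[of 0 0] val[of 1 0] by (simp_all add: pathstart_def pathfinish_def)
  ultimately show ?thesis using path image by blast
qed

end
end

context
  fixes M :: "'a::euclidean_space set" and \<alpha> :: real
  assumes comp: "compact M" and \<alpha>: "0 < \<alpha>" "ereal \<alpha> \<le> reach M"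
begin

lemma geodesic_dist_le_arc_bound:
  assumes ab: "a \<in> M" "b \<in> M" and d: "dist a b < 2 * \<alpha>"
  shows "geodesic_dist M a b \<le> ereal (arc_bound \<alpha> (dist a b))"
proof -
  define r where "r = dist a b"
  define \<kappa> where "\<kappa> = sqrt (1 / (1 + sqrt (1 - (r / (2 * \<alpha>))\<^sup>2)))"
  have "r / (2 * \<alpha>) < 1" "0 \<le> r / (2 * \<alpha>)" using d \<alpha> by (auto simp: r_def)
  then have "(r / (2 * \<alpha>))\<^sup>2 < 1" by (intro power_less_one_iff[THEN iffD2] conjI disjI1) auto
  then have "0 < sqrt (1 - (r / (2 * \<alpha>))\<^sup>2)" by simp
  then have "0 \<le> 1 / (1 + sqrt (1 - (r / (2 * \<alpha>))\<^sup>2))" "1 / (1 + sqrt (1 - (r / (2 * \<alpha>))\<^sup>2)) < 1"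
    by (auto simp del: real_sqrt_gt_0_iff)
  then have \<kappa>: "0 \<le> \<kappa>" "\<kappa> < 1" unfolding \<kappa>_def by (auto simp del: real_sqrt_gt_0_iff)
  have r: "r < 2 * \<alpha>" using d by (simp add: r_def)
  have "\<exists>p. p \<in> M \<and> dist u p \<le> \<kappa> * dist u v \<and> dist p v \<le> \<kappa> * dist u v \<and>
      arc_bound \<alpha> (dist u p) + arc_bound \<alpha> (dist p v) \<le> arc_bound \<alpha> (dist u v)"
    if "u \<in> M" "v \<in> M" "dist u v \<le> r" for u v
    using arc_midpoint[OF comp \<alpha> that r] unfolding \<kappa>_def by blast
  then obtain mid where mid: "\<And>u v. u \<in> M \<Longrightarrow> v \<in> M \<Longrightarrow> dist u v \<le> r \<Longrightarrow>
      mid u v \<in> M \<and> dist u (mid u v) \<le> \<kappa> * dist u v \<and> dist (mid u v) v \<le> \<kappa> * dist u v \<and>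
      arc_bound \<alpha> (dist u (mid u v)) + arc_bound \<alpha> (dist (mid u v) v) \<le> arc_bound \<alpha> (dist u v)"
    by metis
  have "dist u v \<le> arc_bound \<alpha> (dist u v)" if "dist u v \<le> r" for u v :: 'a
    using that r \<alpha> by (intro le_arc_bound) auto
  note A_bound = this
  have "\<exists>g. path g \<and> path_image g \<subseteq> M \<and> pathstart g = a \<and> pathfinish g = b \<and>
      curve_length g \<le> ereal (arc_bound \<alpha> (dist a b))"
  proof (rule dyadic_curve[where S = M and A = "\<lambda>u v. arc_bound \<alpha> (dist u v)" and mid = mid and r = r])
    show "closed M" by (rule compact_imp_closed[OF comp])
    show "dist a b \<le> r" by (simp add: r_def)
    fix u v assume uv: "u \<in> M" "v \<in> M" "dist u v \<le> r"
    show "dist u v \<le> arc_bound \<alpha> (dist u v)" by (rule A_bound[OF uv(3)])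
    show "mid u v \<in> M" "dist u (mid u v) \<le> \<kappa> * dist u v" "dist (mid u v) v \<le> \<kappa> * dist u v"
      "arc_bound \<alpha> (dist u (mid u v)) + arc_bound \<alpha> (dist (mid u v) v) \<le> arc_bound \<alpha> (dist u v)"
      using mid[OF uv] by auto
  qed (fact ab \<kappa>)+
  then obtain g where "path g" "path_image g \<subseteq> M" "pathstart g = a" "pathfinish g = b"
    and len: "curve_length g \<le> ereal (arc_bound \<alpha> (dist a b))" by (elim exE conjE)
  then have "geodesic_dist M a b \<le> curve_length g" by (intro geodesic_dist_le_curve_length)
  from this len show ?thesis by (rule order_trans)
qed

lemma geodesic_dist_le_pi_half:
  assumes "a \<in> M" "b \<in> M" "dist a b < 2 * \<alpha>"
  shows "geodesic_dist M a b \<le> ereal (pi / 2 * dist a b)"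
proof -
  have "ereal (arc_bound \<alpha> (dist a b)) \<le> ereal (pi / 2 * dist a b)"
    using arc_bound_le_pi_half[of \<alpha> "dist a b"] assms \<alpha> by simp
  with geodesic_dist_le_arc_bound[OF assms] show ?thesis by (rule order_trans)
qed

text \<open>Being at finite geodesic distance is an equivalence relation with open classes.\<close>

lemma connected_imp_rectifiably_connected:
  assumes "connected M"
  shows "rectifiably_connected M"
proof -
  have near: "geodesic_dist M x z < \<infinity>" if "x \<in> M" "z \<in> M" "dist x z < 2 * \<alpha>" for x z
    using geodesic_dist_le_pi_half[OF that] by (rule order.strict_trans1) simp
  have "geodesic_dist M u v < \<infinity>" if "u \<in> M" "v \<in> M" for u v
  proof (rule connected_equivalence_relation[OF assms that, where R = "\<lambda>u v. geodesic_dist M u v < \<infinity>"])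
    show "geodesic_dist M x y < \<infinity> \<Longrightarrow> geodesic_dist M y x < \<infinity>" for x y
      by (simp add: geodesic_dist_commute)
    show "geodesic_dist M x z < \<infinity>" if "geodesic_dist M x y < \<infinity>" "geodesic_dist M y z < \<infinity>" for x y z
      using that geodesic_dist_triangle[of M x z y] by (auto simp: less_top[symmetric])
    show "\<exists>T. openin (top_of_set M) T \<and> x \<in> T \<and> (\<forall>z\<in>T. geodesic_dist M x z < \<infinity>)" if "x \<in> M" for x
      using that near \<alpha> by (intro exI[of _ "M \<inter> ball x (2 * \<alpha>)"]) (auto simp: openin_open_Int)
  qed
  then show ?thesis
    unfolding rectifiably_connected_def geodesic_dist_def Inf_less_iff by blast
qed

text \<open>The geodesic distance from a fixed point is continuous, hence bounded on the compact set \<open>M\<close>.\<close>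

lemma intrinsic_diameter_finite:
  assumes "connected M" "M \<noteq> {}"
  shows "\<exists>D. intrinsic_diameter M = ereal D \<and> (\<forall>u\<in>M. \<forall>v\<in>M. gdist M u v \<le> D)"
proof -
  note rc = connected_imp_rectifiably_connected[OF assms(1)]
  obtain c where c: "c \<in> M" using assms by blast
  have near: "gdist M u v \<le> pi / 2 * dist u v" if "u \<in> M" "v \<in> M" "dist u v < 2 * \<alpha>" for u v
    using geodesic_dist_le_pi_half[OF that] geodesic_dist_eq_gdist[OF rc that(1,2)] by simp
  have "continuous_on M (gdist M c)"
    unfolding continuous_on_iff
  proof (intro ballI allI impI)
    fix u and e :: real assume u: "u \<in> M" and e: "0 < e"
    have "dist (gdist M c v) (gdist M c u) < e" if v: "v \<in> M" and d: "dist v u < min (2 * \<alpha>) (e / pi)" for v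
    proof -
      have "gdist M v u \<le> pi / 2 * dist v u" using near v u d by simp
      also have "\<dots> < e" using d pi_gt_zero by (simp add: field_simps) (smt (verit) zero_le_dist mult_nonneg_nonneg pi_ge_zero)
      finally show ?thesis
        using gdist_triangle[OF rc c v u] gdist_triangle[OF rc c u v] gdist_commute[OF rc, of u v]
        by (simp add: dist_real_def)
    qed
    then show "\<exists>d>0. \<forall>x'\<in>M. dist x' u < d \<longrightarrow> dist (gdist M c x') (gdist M c u) < e"
      using \<alpha> e by (intro exI[of _ "min (2 * \<alpha>) (e / pi)"]) auto
  qed
  then have "bounded (gdist M c ` M)" using comp by (intro compact_imp_bounded compact_continuous_image)
  then obtain B where "\<forall>x\<in>gdist M c ` M. norm x \<le> B" unfolding bounded_iff by blast
  then have B: "\<And>u. u \<in> M \<Longrightarrow> gdist M c u \<le> B" by force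
  have "geodesic_dist M u v \<le> ereal (2 * B)" if "u \<in> M" "v \<in> M" for u v
    using gdist_triangle[OF rc that(1) c that(2)] B[OF that(1)] B[OF that(2)] gdist_commute[OF rc, of u c]
    by (simp add: geodesic_dist_eq_gdist[OF rc that])
  then have le: "intrinsic_diameter M \<le> ereal (2 * B)"
    unfolding intrinsic_diameter_def by (intro SUP_least)
  have upper: "geodesic_dist M u v \<le> intrinsic_diameter M" if "u \<in> M" "v \<in> M" for u v
    unfolding intrinsic_diameter_def using that by (intro SUP_upper2[of u] SUP_upper)
  have "0 \<le> intrinsic_diameter M" using upper[OF c c] geodesic_dist_nonneg order_trans by blast
  then obtain D where D: "intrinsic_diameter M = ereal D" using le by (cases "intrinsic_diameter M") auto
  then show ?thesis
    using upper geodesic_dist_eq_gdist[OF rc] by auto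
qed

text \<open>A chord shorter than \<open>2 \<alpha>\<close> is at least \<open>2 / \<pi>\<close> times its arc, and any other chord is at least \<open>2 \<alpha> / D\<close>
times the geodesic distance. The second point of \<open>M\<close> makes \<open>D\<close> positive.\<close>

lemma embedding_assms_of_reach:
  assumes conn: "connected M" and two: "u\<^sub>0 \<in> M" "v\<^sub>0 \<in> M" "u\<^sub>0 \<noteq> v\<^sub>0"
  shows "embedding_assms M \<alpha> (1 / (3 * \<alpha> * sqrt 3))
    (min (2 / pi) (2 * \<alpha> / real_of_ereal (intrinsic_diameter M)))"
proof -
  note rc = connected_imp_rectifiably_connected[OF conn]
  obtain D where D: "intrinsic_diameter M = ereal D" "\<And>u v. u \<in> M \<Longrightarrow> v \<in> M \<Longrightarrow> gdist M u v \<le> D"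
    using intrinsic_diameter_finite[OF conn] two by blast
  have Dpos: "0 < D" using D(2)[OF two(1,2)] gdist_pos[OF rc two] by linarith
  have arc: "gdist M u v \<le> arc_bound \<alpha> (dist u v)" if "u \<in> M" "v \<in> M" "dist u v < 2 * \<alpha>" for u v
    using geodesic_dist_le_arc_bound[OF that] geodesic_dist_eq_gdist[OF rc that(1,2)] by simp
  have quad: "gdist M u v \<le> norm (u - v) + 1 / (3 * \<alpha> * sqrt 3) * (norm (u - v))\<^sup>2"
    if uv: "u \<in> M" "v \<in> M" "gdist M u v \<le> \<alpha>" for u v
  proof -
    have d: "dist u v \<le> \<alpha>" using dist_le_gdist[OF rc uv(1,2)] uv(3) by linarith
    have "gdist M u v \<le> arc_bound \<alpha> (dist u v)" using d \<alpha> by (intro arc uv) auto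
    also have "\<dots> \<le> dist u v + 1 / (3 * \<alpha> * sqrt 3) * (dist u v)\<^sup>2"
      using d \<alpha> by (intro arc_bound_quadratic) auto
    finally show ?thesis by (simp add: dist_norm)
  qed
  have ratio: "min (2 / pi) (2 * \<alpha> / D) \<le> norm (u - v) / gdist M u v"
    if uv: "u \<in> M" "v \<in> M" "u \<noteq> v" for u v
  proof -
    have g: "0 < gdist M u v" by (rule gdist_pos[OF rc uv])
    show ?thesis
    proof (cases "dist u v < 2 * \<alpha>")
      case True
      have "gdist M u v \<le> arc_bound \<alpha> (dist u v)" by (rule arc[OF uv(1,2) True])
      also have "\<dots> \<le> pi / 2 * dist u v" using True \<alpha> by (intro arc_bound_le_pi_half) auto
      finally have "2 / pi \<le> norm (u - v) / gdist M u v"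
        using g by (simp add: dist_norm field_simps)
      then show ?thesis by linarith
    next
      case False
      have "2 * \<alpha> / D \<le> 2 * \<alpha> / gdist M u v"
        using D(2)[OF uv(1,2)] g Dpos \<alpha> by (intro divide_left_mono) auto
      also have "\<dots> \<le> norm (u - v) / gdist M u v"
        using False g by (intro divide_right_mono) (auto simp: dist_norm)
      finally show ?thesis by linarith
    qed
  qed
  have "min (2 / pi) (2 * \<alpha> / D) \<le> C2_bar M"
    unfolding C2_bar_def by (rule cInf_greatest) (use two ratio in blast)+
  then show ?thesis
    unfolding embedding_assms_def D(1) real_of_ereal.simps
    using comp rc \<alpha>(1) quad Dpos by (intro conjI ballI impI) simp_all
qed

end

section \<open>The reach of compact submanifolds\<close>

text \<open>Velocities of curves in \<open>M\<close> passing through \<open>a\<close>; the normal vectors at \<open>a\<close> are those orthogonal to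
all of them.\<close>

definition tangent_vector :: "'a::real_normed_vector set \<Rightarrow> 'a \<Rightarrow> 'a \<Rightarrow> bool" where
  "tangent_vector M a v \<longleftrightarrow>
     (\<exists>\<gamma>. \<gamma> 0 = a \<and> (\<exists>d>0. \<forall>t. \<bar>t\<bar> < d \<longrightarrow> \<gamma> t \<in> M) \<and> (\<gamma> has_vector_derivative v) (at (0::real)))"

lemma C11_on_local_bound:
  fixes f :: "'a::real_normed_vector \<Rightarrow> 'b::real_normed_vector"
  assumes f: "C11_on U f" and U: "open U" "p \<in> U"
  obtains f' e B where "0 < e" "0 \<le> B" "ball p e \<subseteq> U"
    "\<And>x. x \<in> ball p e \<Longrightarrow> (f has_derivative blinfun_apply (f' x)) (at x)"
    "\<And>x y. x \<in> ball p e \<Longrightarrow> y \<in> ball p e \<Longrightarrow> norm (f' x - f' y) \<le> B * norm (x - y)"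
    "\<And>x. x \<in> ball p e \<Longrightarrow> norm (f' x) \<le> B"
proof -
  obtain f' where der: "\<forall>x\<in>U. (f has_derivative blinfun_apply (f' x)) (at x)"
    and lip: "\<forall>x\<in>U. \<exists>e>0. \<exists>L. L-lipschitz_on (ball x e \<inter> U) f'"
    using f unfolding C11_on_def by blast
  obtain e\<^sub>1 L where e1: "e\<^sub>1 > 0" and L: "L-lipschitz_on (ball p e\<^sub>1 \<inter> U) f'" using lip U(2) by blast
  obtain e\<^sub>2 where e2: "e\<^sub>2 > 0" "ball p e\<^sub>2 \<subseteq> U" using U open_contains_ball by blast
  define e where "e = min (min e\<^sub>1 e\<^sub>2) 1"
  define B where "B = L + norm (f' p)"
  have L0: "0 \<le> L" using L by (rule lipschitz_on_nonneg)
  have e: "0 < e" "ball p e \<subseteq> ball p e\<^sub>1 \<inter> U" "e \<le> 1" using e1 e2 by (auto simp: e_def)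
  have lipB: "norm (f' x - f' y) \<le> L * norm (x - y)" if "x \<in> ball p e" "y \<in> ball p e" for x y
    using lipschitz_onD[OF L, of x y] that e(2) unfolding dist_norm by blast
  show ?thesis
  proof (rule that[of e B f'])
    show "0 < e" "ball p e \<subseteq> U" "0 \<le> B" using e L0 by (auto simp: B_def)
    show "(f has_derivative blinfun_apply (f' x)) (at x)" if "x \<in> ball p e" for x
      using der e(2) that by blast
    show "norm (f' x - f' y) \<le> B * norm (x - y)" if "x \<in> ball p e" "y \<in> ball p e" for x y
    proof -
      have "L * norm (x - y) \<le> B * norm (x - y)" by (intro mult_right_mono) (auto simp: B_def)
      with lipB[OF that] show ?thesis by linarith
    qed
    show "norm (f' x) \<le> B" if "x \<in> ball p e" for x
    proof -
      have "norm (f' x) \<le> norm (f' p) + norm (f' x - f' p)" by (rule norm_triangle_sub)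
      also have "norm (f' x - f' p) \<le> L * norm (x - p)" using that e(1) by (intro lipB) auto
      also have "\<dots> \<le> L * 1" using that e(3) L0
        by (intro mult_left_mono) (auto simp: dist_norm norm_minus_commute)
      finally show ?thesis by (simp add: B_def)
    qed
  qed
qed

lemma C11_linearization_error:
  fixes f :: "'a::real_normed_vector \<Rightarrow> 'b::real_normed_vector"
  assumes der: "\<And>x. x \<in> ball p e \<Longrightarrow> (f has_derivative blinfun_apply (f' x)) (at x)"
    and lip: "\<And>x y. x \<in> ball p e \<Longrightarrow> y \<in> ball p e \<Longrightarrow> norm (f' x - f' y) \<le> B * norm (x - y)"
    and "0 \<le> B" and ab: "a \<in> ball p e" "b \<in> ball p e"
  shows "norm (f b - f a - blinfun_apply (f' a) (b - a)) \<le> B * (norm (b - a))\<^sup>2"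
proof -
  let ?S = "closed_segment a b"
  have sub: "?S \<subseteq> ball p e" using ab by (simp add: closed_segment_subset)
  have "norm (f b - f a - blinfun_apply (f' a) (b - a)) \<le> norm (b - a) * (B * norm (b - a))"
  proof (rule differentiable_bound_linearization[where S = ?S and f = f and a = a and b = b
        and f' = "\<lambda>x. blinfun_apply (f' x)" and ?x0.0 = a])
    show "a + t *\<^sub>R (b - a) \<in> ?S" if "t \<in> {0..1}" for t
    proof -
      have "a + t *\<^sub>R (b - a) = (1 - t) *\<^sub>R a + t *\<^sub>R b" by (simp add: algebra_simps)
      with that show ?thesis unfolding in_segment(1) by (intro exI[of _ t] conjI) auto
    qed
    show "(f has_derivative blinfun_apply (f' x)) (at x within ?S)" if "x \<in> ?S" for x
      by (rule has_derivative_at_withinI[OF der[OF subsetD[OF sub that]]])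
    show "onorm (blinfun_apply (f' x) - blinfun_apply (f' a)) \<le> B * norm (b - a)" if x: "x \<in> ?S" for x
    proof -
      have "onorm (blinfun_apply (f' x) - blinfun_apply (f' a)) = norm (f' x - f' a)"
        by (simp add: norm_blinfun.rep_eq minus_blinfun.rep_eq fun_diff_def)
      also have "\<dots> \<le> B * norm (x - a)" by (rule lip[OF subsetD[OF sub x] ab(1)])
      also have "\<dots> \<le> B * norm (b - a)"
        using segment_bound(1)[OF x] \<open>0 \<le> B\<close> by (intro mult_left_mono) auto
      finally show ?thesis .
    qed
  qed simp
  then show ?thesis by (simp add: power2_eq_square mult_ac)
qed

text \<open>In a chart, \<open>b - a\<close> is approximated by the image of \<open>\<phi> b - \<phi> a\<close> under the derivative of \<open>\<psi>\<close> at \<open>\<phi> a\<close>. This is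
the velocity of the image under \<open>\<psi>\<close> of a straight line in the subspace, and the error is quadratic
because the derivative of \<open>\<psi>\<close> is Lipschitz.\<close>

lemma C11_chart_tangent_approximation:
  fixes M :: "'a::euclidean_space set"
  assumes p: "p \<in> U" and U: "open U" and V: "open V" and hom: "homeomorphism U V \<phi> \<psi>"
    and \<phi>: "C11_on U \<phi>" and \<psi>: "C11_on V \<psi>" and L: "subspace L" and chart: "\<phi> ` (M \<inter> U) = V \<inter> L"
  shows "\<exists>\<delta>>0. \<exists>K. \<forall>a\<in>M \<inter> ball p \<delta>. \<forall>b\<in>M \<inter> ball p \<delta>.
           \<exists>v. tangent_vector M a v \<and> norm (b - a - v) \<le> K * (dist a b)\<^sup>2"
proof -
  have \<psi>\<phi>: "\<psi> (\<phi> x) = x" "\<phi> x \<in> V" if "x \<in> U" for x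
    using hom that unfolding homeomorphism_def by auto
  obtain \<phi>' e\<^sub>1 B\<^sub>1 where e1: "0 < e\<^sub>1" "0 \<le> B\<^sub>1" "ball p e\<^sub>1 \<subseteq> U"
    and der1: "\<And>x. x \<in> ball p e\<^sub>1 \<Longrightarrow> (\<phi> has_derivative blinfun_apply (\<phi>' x)) (at x)"
    and B1: "\<And>x. x \<in> ball p e\<^sub>1 \<Longrightarrow> norm (\<phi>' x) \<le> B\<^sub>1"
    by (rule C11_on_local_bound[OF \<phi> U p]) blast
  obtain \<psi>' e\<^sub>2 B\<^sub>2 where e2: "0 < e\<^sub>2" "0 \<le> B\<^sub>2" "ball (\<phi> p) e\<^sub>2 \<subseteq> V"
    and der2: "\<And>x. x \<in> ball (\<phi> p) e\<^sub>2 \<Longrightarrow> (\<psi> has_derivative blinfun_apply (\<psi>' x)) (at x)"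
    and lip2: "\<And>x y. x \<in> ball (\<phi> p) e\<^sub>2 \<Longrightarrow> y \<in> ball (\<phi> p) e\<^sub>2 \<Longrightarrow> norm (\<psi>' x - \<psi>' y) \<le> B\<^sub>2 * norm (x - y)"
    by (rule C11_on_local_bound[OF \<psi> V \<psi>\<phi>(2)[OF p]]) blast
  have lip: "norm (\<phi> x - \<phi> y) \<le> B\<^sub>1 * norm (x - y)" if "x \<in> ball p e\<^sub>1" "y \<in> ball p e\<^sub>1" for x y
  proof (rule differentiable_bound[of "ball p e\<^sub>1" \<phi> "\<lambda>x. blinfun_apply (\<phi>' x)"])
    show "(\<phi> has_derivative blinfun_apply (\<phi>' x)) (at x within ball p e\<^sub>1)" if "x \<in> ball p e\<^sub>1" for x
      using der1[OF that] by (rule has_derivative_at_withinI)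
    show "onorm (blinfun_apply (\<phi>' x)) \<le> B\<^sub>1" if "x \<in> ball p e\<^sub>1" for x
      using B1[OF that] by (simp add: norm_blinfun.rep_eq)
  qed (use that in auto)
  define \<delta> where "\<delta> = min e\<^sub>1 (e\<^sub>2 / (B\<^sub>1 + 1))"
  have \<delta>: "0 < \<delta>" "\<delta> \<le> e\<^sub>1" using e1 e2 by (auto simp: \<delta>_def)
  have \<phi>_ball: "\<phi> x \<in> ball (\<phi> p) e\<^sub>2" if x: "x \<in> ball p \<delta>" for x
  proof -
    have "norm (\<phi> p - \<phi> x) \<le> B\<^sub>1 * norm (p - x)" using x \<delta> e1 by (intro lip) auto
    also have "\<dots> \<le> (B\<^sub>1 + 1) * norm (p - x)" by (intro mult_right_mono) auto
    also have "\<dots> < (B\<^sub>1 + 1) * (e\<^sub>2 / (B\<^sub>1 + 1))"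
      using x e1 by (intro mult_strict_left_mono) (auto simp: \<delta>_def dist_norm)
    also have "\<dots> = e\<^sub>2" using e1 by simp
    finally show ?thesis by (simp add: dist_norm)
  qed
  have "\<exists>v. tangent_vector M a v \<and> norm (b - a - v) \<le> B\<^sub>2 * B\<^sub>1\<^sup>2 * (dist a b)\<^sup>2"
    if a: "a \<in> M \<inter> ball p \<delta>" and b: "b \<in> M \<inter> ball p \<delta>" for a b
  proof (intro exI conjI)
    have aU: "a \<in> U" "b \<in> U" using a b \<delta> e1 by auto
    have \<phi>ab: "\<phi> a \<in> ball (\<phi> p) e\<^sub>2" "\<phi> b \<in> ball (\<phi> p) e\<^sub>2" using a b \<phi>_ball by auto
    have "\<phi> a \<in> V \<inter> L" "\<phi> b \<in> V \<inter> L" using a b aU chart by auto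
    then have inL: "\<phi> a \<in> L" "\<phi> b - \<phi> a \<in> L" using L by (auto intro: subspace_diff)
    define w where "w = \<phi> b - \<phi> a"
    define \<gamma> where "\<gamma> = (\<lambda>t. \<psi> (\<phi> a + t *\<^sub>R w))"
    show "tangent_vector M a (blinfun_apply (\<psi>' (\<phi> a)) (\<phi> b - \<phi> a))"
      unfolding tangent_vector_def w_def[symmetric]
    proof (intro exI[of _ \<gamma>] conjI)
      show "\<gamma> 0 = a" using \<psi>\<phi> aU by (simp add: \<gamma>_def)
      have "open ((\<lambda>t. \<phi> a + t *\<^sub>R w) -` V)"
        using V by (intro open_vimage continuous_intros)
      moreover have "0 \<in> (\<lambda>t. \<phi> a + t *\<^sub>R w) -` V" using \<psi>\<phi> aU by simp
      ultimately obtain d where d: "d > 0" "ball 0 d \<subseteq> (\<lambda>t. \<phi> a + t *\<^sub>R w) -` V"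
        using open_contains_ball by blast
      have "\<gamma> t \<in> M" if t: "\<bar>t\<bar> < d" for t
      proof -
        have "\<phi> a + t *\<^sub>R w \<in> V" using d(2) t by (auto simp: dist_norm)
        moreover have "\<phi> a + t *\<^sub>R w \<in> L" using inL L by (auto simp: w_def intro: subspace_add subspace_scale)
        ultimately have "\<phi> a + t *\<^sub>R w \<in> \<phi> ` (M \<inter> U)" using chart by blast
        then show ?thesis using \<psi>\<phi>(1) by (auto simp: \<gamma>_def)
      qed
      then show "\<exists>d>0. \<forall>t. \<bar>t\<bar> < d \<longrightarrow> \<gamma> t \<in> M" using d(1) by blast
      have "((\<lambda>t. \<phi> a + t *\<^sub>R w) has_derivative (\<lambda>t. t *\<^sub>R w)) (at 0)"
        by (auto intro!: derivative_eq_intros)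
      moreover have "(\<psi> has_derivative blinfun_apply (\<psi>' (\<phi> a))) (at (\<phi> a + 0 *\<^sub>R w))"
        using der2[OF \<phi>ab(1)] by simp
      ultimately have "(\<gamma> has_derivative (\<lambda>t. blinfun_apply (\<psi>' (\<phi> a)) (t *\<^sub>R w))) (at 0)"
        unfolding \<gamma>_def by (rule has_derivative_compose)
      then show "(\<gamma> has_vector_derivative blinfun_apply (\<psi>' (\<phi> a)) w) (at 0)"
        by (simp add: has_vector_derivative_def blinfun.scaleR_right)
    qed
    have "norm (b - a - blinfun_apply (\<psi>' (\<phi> a)) (\<phi> b - \<phi> a)) \<le> B\<^sub>2 * (norm (\<phi> b - \<phi> a))\<^sup>2"
      using C11_linearization_error[OF der2 lip2 e2(2) \<phi>ab] \<psi>\<phi> aU by simp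
    also have "\<dots> \<le> B\<^sub>2 * (B\<^sub>1 * norm (b - a))\<^sup>2"
      using lip[of b a] a b \<delta> e2 by (intro mult_left_mono power_mono) auto
    also have "\<dots> = B\<^sub>2 * B\<^sub>1\<^sup>2 * (dist a b)\<^sup>2" by (simp add: power_mult_distrib dist_norm norm_minus_commute)
    finally show "norm (b - a - blinfun_apply (\<psi>' (\<phi> a)) (\<phi> b - \<phi> a)) \<le> B\<^sub>2 * B\<^sub>1\<^sup>2 * (dist a b)\<^sup>2" .
  qed
  then show ?thesis using \<delta>(1) by blast
qed

text \<open>Near the diagonal the tangential part of \<open>b - a\<close> contributes nothing to \<open>n \<bullet> (b - a)\<close> and the remainder
is quadratic, with a uniform constant by compactness; away from the diagonal the estimate is trivial.\<close>

lemma C11_normal_estimate: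
  fixes M :: "'a::euclidean_space set"
  assumes M: "C11_submanifold M" and comp: "compact M"
  shows "\<exists>K>0. \<forall>a\<in>M. \<forall>b\<in>M. \<forall>n. (\<forall>v. tangent_vector M a v \<longrightarrow> n \<bullet> v = 0) \<longrightarrow>
           n \<bullet> (b - a) \<le> K * norm n * (dist a b)\<^sup>2"
proof -
  have "\<forall>p\<in>M. \<exists>\<delta>>0. \<exists>K. \<forall>a\<in>M \<inter> ball p \<delta>. \<forall>b\<in>M \<inter> ball p \<delta>.
           \<exists>v. tangent_vector M a v \<and> norm (b - a - v) \<le> K * (dist a b)\<^sup>2"
  proof
    fix p assume p: "p \<in> M"
    obtain m where m: "\<forall>p\<in>M. \<exists>U (V :: 'a set) \<phi> \<psi> L.
        open U \<and> p \<in> U \<and> open V \<and> homeomorphism U V \<phi> \<psi> \<and> C11_on U \<phi> \<and> C11_on V \<psi> \<and>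
        subspace L \<and> dim L = m \<and> \<phi> ` (M \<inter> U) = V \<inter> L"
      using M unfolding C11_submanifold_def by (rule exE)
    obtain U V L and \<phi> \<psi> :: "'a \<Rightarrow> 'a" where
      "open U" "p \<in> U" "open V" "homeomorphism U V \<phi> \<psi>" "C11_on U \<phi>" "C11_on V \<psi>"
      "subspace L" "\<phi> ` (M \<inter> U) = V \<inter> L" using bspec[OF m p] by (elim exE conjE)
    then show "\<exists>\<delta>>0. \<exists>K. \<forall>a\<in>M \<inter> ball p \<delta>. \<forall>b\<in>M \<inter> ball p \<delta>.
           \<exists>v. tangent_vector M a v \<and> norm (b - a - v) \<le> K * (dist a b)\<^sup>2"
      by (intro C11_chart_tangent_approximation)
  qed
  from bchoice[OF this] obtain \<delta> where "\<forall>p\<in>M. 0 < \<delta> p \<and> (\<exists>K. \<forall>a\<in>M \<inter> ball p (\<delta> p).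
      \<forall>b\<in>M \<inter> ball p (\<delta> p). \<exists>v. tangent_vector M a v \<and> norm (b - a - v) \<le> K * (dist a b)\<^sup>2)"
    by (rule exE)
  then have \<delta>: "\<And>p. p \<in> M \<Longrightarrow> \<delta> p > 0"
    and "\<forall>p\<in>M. \<exists>K. \<forall>a\<in>M \<inter> ball p (\<delta> p).
      \<forall>b\<in>M \<inter> ball p (\<delta> p). \<exists>v. tangent_vector M a v \<and> norm (b - a - v) \<le> K * (dist a b)\<^sup>2"
    by simp_all
  from bchoice[OF this(2)] obtain K where K: "\<forall>p\<in>M. \<forall>a\<in>M \<inter> ball p (\<delta> p).
      \<forall>b\<in>M \<inter> ball p (\<delta> p). \<exists>v. tangent_vector M a v \<and> norm (b - a - v) \<le> K p * (dist a b)\<^sup>2"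
    by (rule exE)
  have "M \<subseteq> (\<Union>p\<in>M. ball p (\<delta> p))" using \<delta> by force
  then obtain C where C: "C \<subseteq> M" "finite C" "M \<subseteq> (\<Union>p\<in>C. ball p (\<delta> p))"
    by (rule compactE_image[OF comp open_ball])
  obtain e where e: "0 < e" "\<And>x. x \<in> M \<Longrightarrow> \<exists>G \<in> (\<lambda>p. ball p (\<delta> p)) ` C. ball x e \<subseteq> G"
    by (rule Heine_Borel_lemma[OF comp C(3)]) auto
  define K\<^sub>0 where "K\<^sub>0 = (\<Sum>p\<in>C. \<bar>K p\<bar>) + 1 / e"
  have sum0: "0 \<le> (\<Sum>p\<in>C. \<bar>K p\<bar>)" by (intro sum_nonneg) auto
  have K0: "0 < K\<^sub>0" "1 / e \<le> K\<^sub>0" using sum0 e by (auto simp: K\<^sub>0_def intro: add_nonneg_pos)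
  have "n \<bullet> (b - a) \<le> K\<^sub>0 * norm n * (dist a b)\<^sup>2"
    if ab: "a \<in> M" "b \<in> M" and n: "\<forall>v. tangent_vector M a v \<longrightarrow> n \<bullet> v = 0" for a b n
  proof (cases "dist a b < e")
    case True
    obtain p where p: "p \<in> C" "ball a e \<subseteq> ball p (\<delta> p)" using e(2)[OF ab(1)] by blast
    have in_ball: "a \<in> M \<inter> ball p (\<delta> p)" "b \<in> M \<inter> ball p (\<delta> p)"
      using ab subsetD[OF p(2), of a] subsetD[OF p(2), of b] e(1) True by simp_all
    have pM: "p \<in> M" using p(1) C(1) by blast
    obtain v where v: "tangent_vector M a v" "norm (b - a - v) \<le> K p * (dist a b)\<^sup>2"
      using bspec[OF bspec[OF bspec[OF K pM] in_ball(1)] in_ball(2)] by (elim exE conjE)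
    have "K p \<le> (\<Sum>p\<in>C. \<bar>K p\<bar>)"
      using member_le_sum[OF p(1), of "\<lambda>p. \<bar>K p\<bar>"] C(2) by simp
    then have Kp: "K p \<le> K\<^sub>0" using e(1) by (simp add: K\<^sub>0_def add_increasing2)
    have "n \<bullet> (b - a) = n \<bullet> (b - a - v)" using n v(1) by (simp add: inner_diff_right)
    also have "\<dots> \<le> norm n * norm (b - a - v)" by (rule norm_cauchy_schwarz)
    also have "\<dots> \<le> norm n * (K\<^sub>0 * (dist a b)\<^sup>2)"
      using v(2) mult_right_mono[OF Kp, of "(dist a b)\<^sup>2"] by (intro mult_left_mono) auto
    finally show ?thesis by (simp add: mult_ac)
  next
    case False
    have "n \<bullet> (b - a) \<le> norm n * dist a b"
      using norm_cauchy_schwarz[of n "b - a"] by (simp add: dist_norm norm_minus_commute)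
    also have "\<dots> \<le> norm n * (1 / e * (dist a b)\<^sup>2)"
    proof (rule mult_left_mono)
      have "dist a b * e \<le> dist a b * dist a b" using False by (intro mult_left_mono) auto
      then show "dist a b \<le> 1 / e * (dist a b)\<^sup>2" using e(1) by (simp add: field_simps power2_eq_square)
    qed simp
    also have "\<dots> \<le> norm n * (K\<^sub>0 * (dist a b)\<^sup>2)"
      using K0 by (intro mult_left_mono mult_right_mono) auto
    finally show ?thesis by (simp add: mult_ac)
  qed
  then show ?thesis using K0(1) by blast
qed

text \<open>The squared distance to \<open>x\<close> along a curve through \<open>a\<close> has a local extremum at \<open>a\<close>.\<close>

lemma tangent_orthogonal_at_extremum:
  fixes M :: "'a::real_inner set"
  assumes v: "tangent_vector M a v"
    and ext: "(\<forall>b\<in>M. dist x a \<le> dist x b) \<or> (\<forall>b\<in>M. dist x b \<le> dist x a)"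
  shows "(x - a) \<bullet> v = 0"
proof -
  obtain \<gamma> d where \<gamma>0: "\<gamma> 0 = a" and d: "d > 0" and in_M: "\<forall>t. \<bar>t\<bar> < d \<longrightarrow> \<gamma> t \<in> M"
    and der: "(\<gamma> has_vector_derivative v) (at (0::real))"
    using v unfolding tangent_vector_def by (elim exE conjE)
  define g where "g = (\<lambda>t. (x - \<gamma> t) \<bullet> (x - \<gamma> t))"
  have g: "g t = (dist x (\<gamma> t))\<^sup>2" for t by (simp add: g_def dist_norm power2_norm_eq_inner)
  have "((\<lambda>t. x - \<gamma> t) has_derivative (\<lambda>t. - (t *\<^sub>R v))) (at 0)"
    using der unfolding has_vector_derivative_def by (auto intro!: derivative_eq_intros)
  from has_derivative_inner[OF this this]
  have "(g has_derivative (\<lambda>t. (x - a) \<bullet> - (t *\<^sub>R v) + - (t *\<^sub>R v) \<bullet> (x - a))) (at 0)"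
    by (simp add: g_def \<gamma>0)
  moreover have "(\<lambda>t. (x - a) \<bullet> - (t *\<^sub>R v) + - (t *\<^sub>R v) \<bullet> (x - a)) = (*) (- 2 * ((x - a) \<bullet> v))"
    by (auto simp: inner_commute)
  ultimately have D: "DERIV g 0 :> - 2 * ((x - a) \<bullet> v)" by (simp add: has_field_derivative_def)
  from ext have "- 2 * ((x - a) \<bullet> v) = 0"
  proof
    assume "\<forall>b\<in>M. dist x a \<le> dist x b"
    then have "\<forall>t. \<bar>0 - t\<bar> < d \<longrightarrow> g 0 \<le> g t"
      unfolding g using \<gamma>0 in_M by (auto intro!: power_mono)
    with D d show ?thesis by (rule DERIV_local_min)
  next
    assume "\<forall>b\<in>M. dist x b \<le> dist x a"
    then have "\<forall>t. \<bar>0 - t\<bar> < d \<longrightarrow> g t \<le> g 0"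
      unfolding g using \<gamma>0 in_M by (auto intro!: power_mono)
    with D d show ?thesis by (rule DERIV_local_max)
  qed
  then show ?thesis by simp
qed

lemma dist_square_expand:
  fixes p a b :: "'a::real_inner"
  shows "(dist p b)\<^sup>2 = (dist p a)\<^sup>2 - 2 * ((p - a) \<bullet> (b - a)) + (dist a b)\<^sup>2"
  by (simp add: dist_norm power2_norm_eq_inner inner_diff_left inner_diff_right inner_commute)

text \<open>If \<open>a\<close> and \<open>b\<close> are both nearest to \<open>p\<close>, then \<open>dist a b ^ 2 = 2 * ((p - a) \<bullet> (b - a))\<close>, which the normal
estimate bounds by \<open>2 * K * dist p a * dist a b ^ 2\<close>. This forces \<open>a = b\<close> for \<open>dist p a < 1 / (2 * K)\<close>.\<close>

lemma C11_reach_pos: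
  fixes M :: "'a::euclidean_space set"
  assumes M: "C11_submanifold M" and comp: "compact M"
  shows "0 < reach M"
proof -
  obtain K where K: "0 < K" and est: "\<And>a b n. a \<in> M \<Longrightarrow> b \<in> M \<Longrightarrow>
      (\<forall>v. tangent_vector M a v \<longrightarrow> n \<bullet> v = 0) \<Longrightarrow> n \<bullet> (b - a) \<le> K * norm n * (dist a b)\<^sup>2"
    using C11_normal_estimate[OF M comp] by blast
  define e where "e = 1 / (2 * K)"
  have "a = b" if near: "nearest M p a" "nearest M p b" and p: "dist p a < e" for p a b
  proof -
    have ab: "a \<in> M" "b \<in> M" "\<And>c. c \<in> M \<Longrightarrow> dist p a \<le> dist p c" "dist p b = dist p a"
      using near unfolding nearest_def by (auto intro: antisym)
    have "(p - a) \<bullet> (b - a) \<le> K * norm (p - a) * (dist a b)\<^sup>2"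
      by (intro est ab allI impI tangent_orthogonal_at_extremum) (use ab in auto)
    moreover have "(dist a b)\<^sup>2 = 2 * ((p - a) \<bullet> (b - a))" using dist_square_expand[of p b a] ab(4) by simp
    ultimately have le: "(dist a b)\<^sup>2 \<le> (2 * K * dist p a) * (dist a b)\<^sup>2" by (simp add: dist_norm)
    have lt: "2 * K * dist p a < 1" using p K by (simp add: e_def field_simps)
    show "a = b"
    proof (rule ccontr)
      assume "a \<noteq> b"
      then have "(2 * K * dist p a) * (dist a b)\<^sup>2 < 1 * (dist a b)\<^sup>2"
        by (intro mult_strict_right_mono lt) simp
      with le show False by simp
    qed
  qed
  then have "uniquely_projecting M e"
    unfolding uniquely_projecting_def
  proof (intro conjI ballI)
    show "0 < e" using K by (simp add: e_def)
    fix p assume "p \<in> (\<Union>q\<in>M. ball q e)"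
    then obtain q where q: "q \<in> M" "dist p q < e" by (auto simp: dist_commute)
    then obtain a where a: "nearest M p a" using nearest_exists[OF comp] by blast
    have "dist p a < e" using a q unfolding nearest_def by (meson order.strict_trans1)
    with a show "\<exists>!a. nearest M p a"
      using \<open>\<And>p b a. \<lbrakk>nearest M p a; nearest M p b; dist p a < e\<rbrakk> \<Longrightarrow> a = b\<close> by (intro ex1I[of _ a]) auto
  qed
  then have "ereal e \<le> reach M" unfolding reach_eq_Sup_uniquely_projecting by (intro Sup_upper) blast
  moreover have "0 < ereal e" using K by (simp add: e_def)
  ultimately show ?thesis by (rule order.strict_trans2[rotated])
qed

text \<open>Let \<open>p\<close> be a point of \<open>M\<close> farthest from the origin, at distance \<open>R\<close>. The vector \<open>u\<close> from \<open>p\<close> towards the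
origin is normal, so by the normal estimate \<open>p\<close> is nearest to the points of the ray in direction \<open>u\<close> that
are close to \<open>p\<close>. If the reach exceeded \<open>R\<close>, a ball of radius greater than \<open>R\<close> touching \<open>M\<close> at \<open>p\<close> from this
side would have no point of \<open>M\<close> in its interior. But it contains the ball of radius \<open>R\<close> around the
origin, which contains \<open>M\<close>, and their boundaries meet only at \<open>p\<close>; so \<open>M\<close> would be a single point.\<close>

lemma C11_reach_finite:
  fixes M :: "'a::euclidean_space set"
  assumes M: "C11_submanifold M" and comp: "compact M" and two: "u\<^sub>0 \<in> M" "v\<^sub>0 \<in> M" "u\<^sub>0 \<noteq> v\<^sub>0"
  shows "reach M < \<infinity>"
proof -
  obtain p where p: "p \<in> M" "\<And>b. b \<in> M \<Longrightarrow> dist 0 b \<le> dist 0 p"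
    using distance_attains_sup[OF comp, of 0] two by blast
  define R where "R = norm p"
  have bR: "norm b \<le> R" if "b \<in> M" for b using p(2)[OF that] by (simp add: R_def)
  have R: "0 < R"
  proof (rule ccontr)
    assume "\<not> 0 < R"
    then have "R \<le> 0" by simp
    then have "norm u\<^sub>0 \<le> 0" "norm v\<^sub>0 \<le> 0" using bR two order_trans by blast+
    with two show False by simp
  qed
  define u where "u = (- 1 / R) *\<^sub>R p"
  have u: "norm u = 1" using R by (simp add: u_def R_def)
  obtain K where K: "0 < K" and est: "\<And>a b n. a \<in> M \<Longrightarrow> b \<in> M \<Longrightarrow>
      (\<forall>v. tangent_vector M a v \<longrightarrow> n \<bullet> v = 0) \<Longrightarrow> n \<bullet> (b - a) \<le> K * norm n * (dist a b)\<^sup>2"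
    using C11_normal_estimate[OF M comp] by blast
  have orth: "\<forall>v. tangent_vector M p v \<longrightarrow> u \<bullet> v = 0"
    using tangent_orthogonal_at_extremum[of M p _ 0] p(2) by (simp add: u_def)
  define t where "t = 1 / (2 * K)"
  have t: "0 < t" using K by (simp add: t_def)
  have near: "nearest M (p + t *\<^sub>R u) p"
    unfolding nearest_def
  proof (intro conjI ballI)
    show "p \<in> M" by (rule p(1))
    fix b assume b: "b \<in> M"
    have "2 * (t * (u \<bullet> (b - p))) \<le> 2 * (t * (K * norm u * (dist p b)\<^sup>2))"
      using est[OF p(1) b orth] t by (intro mult_left_mono) auto
    also have "\<dots> = (dist p b)\<^sup>2" using u K by (simp add: t_def)
    finally have "(dist (p + t *\<^sub>R u) p)\<^sup>2 \<le> (dist (p + t *\<^sub>R u) b)\<^sup>2"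
      using dist_square_expand[of "p + t *\<^sub>R u" b p] by simp
    then show "dist (p + t *\<^sub>R u) p \<le> dist (p + t *\<^sub>R u) b" by (rule power2_le_imp_le) simp
  qed
  have "reach M \<le> ereal R"
  proof (rule ccontr)
    assume "\<not> reach M \<le> ereal R"
    then have "ereal R < reach M" by simp
    then obtain \<alpha> where \<alpha>: "ereal R < ereal \<alpha>" "ereal \<alpha> < reach M"
      using ereal_dense2 by blast
    then have R\<alpha>: "R < \<alpha>" by simp
    have only: "b = p" if b: "b \<in> M" for b
    proof -
      define X where "X = R\<^sup>2 - p \<bullet> b"
      have "2 * \<alpha> * (u \<bullet> (b - p)) \<le> (dist p b)\<^sup>2"
        using reach_inner_bound[OF comp less_imp_le[OF \<alpha>(2)] _ u t near b] R R\<alpha> by simp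
      moreover have "u \<bullet> (b - p) = X / R"
        by (simp add: u_def X_def inner_diff_right R_def power2_norm_eq_inner diff_divide_distrib)
      moreover have dX: "(dist p b)\<^sup>2 \<le> 2 * X"
      proof -
        have "(dist p b)\<^sup>2 = R\<^sup>2 - 2 * (p \<bullet> b) + (norm b)\<^sup>2"
          by (simp add: dist_norm R_def power2_norm_eq_inner inner_diff_left inner_diff_right inner_commute)
        moreover have "(norm b)\<^sup>2 \<le> R\<^sup>2" using bR[OF b] by (intro power_mono) auto
        ultimately show ?thesis by (simp add: X_def)
      qed
      ultimately have "\<alpha> * (X / R) \<le> X" by simp
      then have "\<alpha> * X \<le> R * X" using R by (simp add: field_simps)
      then have "(\<alpha> - R) * X \<le> 0" by (simp add: algebra_simps)
      then have "X \<le> 0" using R\<alpha> by (simp add: mult_le_0_iff)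
      with dX have "(dist p b)\<^sup>2 \<le> 0" by linarith
      then show "b = p" by simp
    qed
    show False using only[OF two(1)] only[OF two(2)] two(3) by simp
  qed
  then show ?thesis by (rule order.strict_trans1) simp
qed

section \<open>Approximate isometric embeddings\<close>

theorem proposition5p1:
  fixes M :: "(real ^ 'n) set" and y :: "nat \<Rightarrow> real ^ 'n"
  assumes "inj y" and "range y \<subseteq> M" and "M \<subseteq> closure (range y)"
  shows "(\<forall>\<epsilon>\<^sub>0 C\<^sub>1 C\<^sub>2. embedding_assms M \<epsilon>\<^sub>0 C\<^sub>1 C\<^sub>2 \<longrightarrow> embedding_concl M y \<epsilon>\<^sub>0 C\<^sub>1 C\<^sub>2) \<and>
         (C11_submanifold M \<and> compact M \<and> connected M \<longrightarrow>
            (let \<alpha> = real_of_ereal (reach M);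
                 D = real_of_ereal (intrinsic_diameter M);
                 C\<^sub>1 = 1 / (3 * \<alpha> * sqrt 3);
                 C\<^sub>2 = min (2 / pi) (2 * \<alpha> / D)
             in embedding_assms M \<alpha> C\<^sub>1 C\<^sub>2 \<and> embedding_concl M y \<alpha> C\<^sub>1 C\<^sub>2))"
proof (intro conjI allI impI)
  note concl = embedding_assms_imp_embedding_concl[OF assms]
  show "embedding_concl M y \<epsilon>\<^sub>0 C\<^sub>1 C\<^sub>2" if "embedding_assms M \<epsilon>\<^sub>0 C\<^sub>1 C\<^sub>2" for \<epsilon>\<^sub>0 C\<^sub>1 C\<^sub>2
    using that by (rule concl)
  assume "C11_submanifold M \<and> compact M \<and> connected M"
  then have M: "C11_submanifold M" and comp: "compact M" and conn: "connected M" by auto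
  have two: "y 0 \<in> M" "y 1 \<in> M" "y 0 \<noteq> y 1" using assms(1,2) by (auto dest: injD)
  obtain \<alpha> where \<alpha>: "reach M = ereal \<alpha>"
    using C11_reach_pos[OF M comp] C11_reach_finite[OF M comp two] by (cases "reach M") auto
  then have "0 < \<alpha>" using C11_reach_pos[OF M comp] by simp
  with \<alpha> have "embedding_assms M \<alpha> (1 / (3 * \<alpha> * sqrt 3)) (min (2 / pi) (2 * \<alpha> / real_of_ereal (intrinsic_diameter M)))"
    using embedding_assms_of_reach[OF comp _ _ conn two] by simp
  then show "let \<alpha> = real_of_ereal (reach M);
                 D = real_of_ereal (intrinsic_diameter M);
                 C\<^sub>1 = 1 / (3 * \<alpha> * sqrt 3);
                 C\<^sub>2 = min (2 / pi) (2 * \<alpha> / D)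
             in embedding_assms M \<alpha> C\<^sub>1 C\<^sub>2 \<and> embedding_concl M y \<alpha> C\<^sub>1 C\<^sub>2"
    unfolding Let_def \<alpha> real_of_ereal.simps using concl by blast
qed

end
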